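(* Let $G$ be a connected bipartite planar subcubic graph. Then the exact square $G^{[\sharp 2]}$ consists of two planar connected components, each induced by one part of the bipartition of $G$. Moreover, if $G$ is outerplanar, then these two components are outerplanar.
   Context: A graph is subcubic if its maximum degree is at most $3$. The exact square $G^{[\sharp 2]}$ of a graph $G$ is the graph with vertex set $V(G)$ in which two distinct vertices are adjacent if and only if their distance in $G$ is exactly $2$. *)

theory Defs
  imports
    "HOL-Analysis.Analysis"
    "Graph_Theory.Digraph_Component"
    "Graph_Theory.Shortest_Path"
begin

text \<open>
  Finite simple graphs are the \<open>pair_graph\<close>s of \<open>Graph_Theory\<close>: an undirected edge is represented
  by two opposite arcs. For such graphs the strongly connected components \<open>sccs\<close> are the
  connected components, and the out-degree is the degree.
\<close>

definition subcubic :: "('a, 'b) pre_digraph \<Rightarrow> bool" where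
  "subcubic G \<longleftrightarrow> (\<forall>v \<in> verts G. out_degree G v \<le> 3)"

text \<open>A part may be empty; this happens for connected graphs only if there is a single vertex.\<close>

definition bipartition :: "('a, 'b) pre_digraph \<Rightarrow> 'a set \<Rightarrow> 'a set \<Rightarrow> bool" where
  "bipartition G A B \<longleftrightarrow> A \<union> B = verts G \<and> A \<inter> B = {} \<and>
     (\<forall>(u, v) \<in> arcs_ends G. u \<in> A \<and> v \<in> B \<or> u \<in> B \<and> v \<in> A)"

definition graph_dist :: "('a, 'b) pre_digraph \<Rightarrow> 'a \<Rightarrow> 'a \<Rightarrow> ereal" where
  "graph_dist G = wf_digraph.\<mu> G (\<lambda>_. 1)"

definition exact_square :: "'a pair_pre_digraph \<Rightarrow> 'a pair_pre_digraph" where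
  "exact_square G = \<lparr> pverts = pverts G,
     parcs = {(u, v) \<in> pverts G \<times> pverts G. u \<noteq> v \<and> graph_dist (with_proj G) u v = 2} \<rparr>"

text \<open>
  A drawing in the plane without crossings places the vertices by \<open>p\<close> and represents the
  undirected edge \<open>{u, v}\<close> by the point set \<open>D {u, v}\<close>, which is the image of an injective curve.
\<close>

definition plane_drawing ::
    "('a, 'b) pre_digraph \<Rightarrow> ('a \<Rightarrow> complex) \<Rightarrow> ('a set \<Rightarrow> complex set) \<Rightarrow> bool" where
  "plane_drawing G p D \<longleftrightarrow>
     inj_on p (verts G) \<and>
     (\<forall>(u, v) \<in> arcs_ends G.
        (\<exists>g. arc g \<and> pathstart g = p u \<and> pathfinish g = p v \<and> path_image g = D {u, v}) \<and>
        D {u, v} \<inter> p ` verts G = {p u, p v}) \<and>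
     (\<forall>(u, v) \<in> arcs_ends G. \<forall>(x, y) \<in> arcs_ends G.
        {u, v} \<noteq> {x, y} \<longrightarrow> D {u, v} \<inter> D {x, y} \<subseteq> p ` ({u, v} \<inter> {x, y}))"

definition drawing_points ::
    "('a, 'b) pre_digraph \<Rightarrow> ('a \<Rightarrow> complex) \<Rightarrow> ('a set \<Rightarrow> complex set) \<Rightarrow> complex set" where
  "drawing_points G p D = p ` verts G \<union> (\<Union>(u, v) \<in> arcs_ends G. D {u, v})"

definition planar :: "('a, 'b) pre_digraph \<Rightarrow> bool" where
  "planar G \<longleftrightarrow> (\<exists>p D. plane_drawing G p D)"

text \<open>
  The drawing of a finite graph is compact, so \<open>outside\<close> of it is the single unbounded connected
  component of its complement, i.e. the outer face.
\<close>

definition outerplanar :: "('a, 'b) pre_digraph \<Rightarrow> bool" where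
  "outerplanar G \<longleftrightarrow>
     (\<exists>p D. plane_drawing G p D \<and> p ` verts G \<subseteq> frontier (outside (drawing_points G p D)))"

end

theory Submission
  imports Defs
begin

text \<open>
  Let \<open>b\<close> be a vertex of one part. Its at most three neighbours are pairwise adjacent in the exact square, so
  the component on the other part is drawn by replacing the star of every such \<open>b\<close> by a triangle (or an
  edge) inside a thin neighbourhood of the star.

  The edges of the given drawing are arbitrary arcs, so parallel copies of them are not available. First the
  drawing is changed near the vertices \<open>a\<close> of the other part, so that all edges arrive at \<open>a\<close> straight; this
  only needs arcs from \<open>a\<close> to finitely many boundary points of a small connected region. The stars then
  have disjoint neighbourhoods that contain a convex wedge at each of their leaves. In a connected open set with
  wedges at three boundary points a triangle can be drawn arc by arc: by Janiszewski's theorem, after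
  deletion of an arc that starts straight, every component of the rest still has a wedge at its endpoint.

  In the outerplanar case a closed connected unbounded set in the outer face is chosen, and each vertex is joined to it
  by one more curve, which the neighbourhoods of the stars avoid. So the vertices stay on the boundary of the outer face.
\<close>

text \<open>Otherwise \<open>connected\<close> would denote connectedness of digraphs instead of topological connectedness.\<close>

hide_const (open) Digraph_Component.connected

section \<open>Arcs and wedges\<close>

definition joins :: "complex set \<Rightarrow> complex \<Rightarrow> complex \<Rightarrow> bool" where
  "joins F a b \<longleftrightarrow> (\<exists>g. arc g \<and> pathstart g = a \<and> pathfinish g = b \<and> path_image g = F)"

text \<open>
  A wedge at \<open>a\<close> is a region through which \<open>a\<close> can be reached along a straight segment. Wedges avoid any study
  of accessibility of boundary points by wild arcs: all new curves are straight near the vertices.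
\<close>

definition wedge :: "complex \<Rightarrow> complex set \<Rightarrow> bool" where
  "wedge a C \<longleftrightarrow> open C \<and> convex C \<and> a \<in> closure C - C"

definition spokes :: "complex \<Rightarrow> complex set \<Rightarrow> bool" where
  "spokes a U \<longleftrightarrow> (\<forall>w\<in>U. \<exists>C. wedge a C \<and> C \<subseteq> connected_component_set U w)"

lemma joins_sym: "joins F a b \<Longrightarrow> joins F b a"
  unfolding joins_def by (metis arc_reversepath path_image_reversepath pathfinish_reversepath pathstart_reversepath)

lemma joins_ends: "joins F a b \<Longrightarrow> a \<in> F \<and> b \<in> F \<and> a \<noteq> b"
  unfolding joins_def by (metis arc_distinct_ends pathfinish_in_path_image pathstart_in_path_image)

lemma joins_compact: "joins F a b \<Longrightarrow> compact F"
  unfolding joins_def using compact_arc_image by blast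

lemma joins_segment: "a \<noteq> b \<Longrightarrow> joins (closed_segment a b) a b"
  unfolding joins_def by (metis arc_linepath path_image_linepath pathfinish_linepath pathstart_linepath)

lemma joins_Un:
  assumes "joins F a b" "joins F' b c" "F \<inter> F' \<subseteq> {b}"
  shows "joins (F \<union> F') a c"
proof -
  obtain g where g: "arc g" "pathstart g = a" "pathfinish g = b" "path_image g = F"
    using assms(1) unfolding joins_def by blast
  obtain h where h: "arc h" "pathstart h = b" "pathfinish h = c" "path_image h = F'"
    using assms(2) unfolding joins_def by blast
  have "arc (g +++ h)" using arc_join[of g h] g h assms(3) by auto
  then show ?thesis unfolding joins_def using g h
    by (intro exI[of _ "g +++ h"]) (simp add: path_image_join)
qed

lemma joins_subpath:
  assumes "arc g" "0 \<le> s" "s < t" "t \<le> 1"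
  shows "joins (g ` {s..t}) (g s) (g t)"
  unfolding joins_def using assms arc_subpath_arc[OF assms(1), of s t]
  by (intro exI[of _ "subpath s t g"]) (auto simp: path_image_subpath)

lemma joins_connected:
  assumes "joins F a b" shows "connected (F - {a})" "connected (F - {b})" "connected F"
proof -
  obtain g where g: "arc g" "pathstart g = a" "pathfinish g = b" "path_image g = F"
    using assms unfolding joins_def by blast
  have inj: "inj_on g {0..1}" and cont: "continuous_on {0..1} g" using g(1) by (auto simp: arc_def path_def)
  have F: "F = g ` {0..1}" "a = g 0" "b = g 1" using g by (auto simp: path_image_def pathstart_def pathfinish_def)
  have "{0<..1} = {0..1} - {0::real}" "{0..<1} = {0..1} - {1::real}"
    by auto
  then have "F - {a} = g ` {0<..1}" "F - {b} = g ` {0..<1}"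
    unfolding F by (simp_all add: inj_on_image_set_diff[OF inj])
  then show "connected (F - {a})" "connected (F - {b})" "connected F"
    using cont F by (auto intro!: connected_continuous_image intro: continuous_on_subset)
qed

lemma joins_closure_minus_end:
  assumes "joins F a b" shows "a \<in> closure (F - {a})"
proof -
  have "connected F" using joins_connected[OF assms] by blast
  moreover have "F - {a} \<noteq> {}" "a \<in> F" using joins_ends[OF assms] by auto
  ultimately show ?thesis
    by (metis Diff_cancel Diff_iff closure_def connected_imp_perfect islimpt_insert insert_Diff singletonD UnCI mem_Collect_eq)
qed

lemma connected_Diff_arc:
  assumes V: "open V" "connected V" and F: "joins F c b" and sub: "F - {b} \<subseteq> V"
  shows "connected (V - F)"
proof -
  have "F \<inter> - V = {} \<or> F \<inter> - V = {b}" using sub by auto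
  then have "connected (F \<inter> - V)" by auto
  moreover have "connected (- F)" using F unfolding joins_def using connected_arc_complement by fastforce
  ultimately have "connected (- (F \<union> - V))"
    using Janiszewski_connected[of F "- V"] joins_compact[OF F] V by auto
  then show ?thesis by (simp add: Diff_eq Int_commute)
qed

lemma wedge_mono:
  assumes C: "wedge a C" and D: "open D" "convex D" and c: "c \<in> C" and r: "r > 0"
    and ray: "\<And>t. 0 < t \<Longrightarrow> t < r \<Longrightarrow> a + of_real t * (c - a) \<in> D"
  shows "wedge a (C \<inter> D)"
proof -
  have C': "open C" "convex C" "a \<in> closure C" "a \<notin> C" using C by (auto simp: wedge_def)
  have seg: "open_segment c a \<subseteq> C"
    using in_interior_closure_convex_segment[OF C'(2)] c C' by (simp add: interior_open)
  have "c \<noteq> a" using c C' by auto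
  have "a + of_real t * (c - a) \<in> C \<inter> D" if t: "0 < t" "t < min r 1" for t
  proof -
    have "a + of_real t * (c - a) \<in> open_segment c a"
      unfolding in_segment using \<open>c \<noteq> a\<close> t
      by (intro conjI exI[of _ "1 - t"]) (auto simp: algebra_simps scaleR_conv_of_real)
    then show ?thesis using seg ray t by auto
  qed
  note mem = this
  have "((\<lambda>t. a + of_real t * (c - a)) \<longlongrightarrow> a + of_real 0 * (c - a)) (at_right (0::real))"
    by (intro tendsto_intros)
  moreover have "eventually (\<lambda>t. a + of_real t * (c - a) \<in> closure (C \<inter> D)) (at_right (0::real))"
    unfolding eventually_at_right_field using mem r closure_subset
    by (intro exI[of _ "min r 1"]) (auto intro!: closure_subset[THEN subsetD])
  ultimately have "a \<in> closure (C \<inter> D)"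
    using Lim_in_closed_set[OF closed_closure, of _ "C \<inter> D" "at_right (0::real)" a] by force
  then show ?thesis using C' D unfolding wedge_def by (auto intro: convex_Int)
qed

lemma wedge_ball:
  assumes "wedge a C" "r > 0" shows "wedge a (C \<inter> ball a r)"
proof -
  obtain c where c: "c \<in> C" using assms(1) unfolding wedge_def by fastforce
  have ca: "norm (c - a) > 0" using c assms(1) unfolding wedge_def by force
  show ?thesis
  proof (rule wedge_mono[OF assms(1) _ _ c, of _ "r / norm (c - a)"])
    fix t assume "0 < t" "t < r / norm (c - a)"
    then have "dist a (a + of_real t * (c - a)) < r" using ca
      by (simp add: dist_norm norm_mult pos_less_divide_eq)
    then show "a + of_real t * (c - a) \<in> ball a r" by simp
  qed (use ca assms in auto)
qed

lemma wedge_halfplane: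
  assumes "wedge a C" "x \<in> C" "inner n (x - a) > 0"
  shows "wedge a (C \<inter> {y. inner n (y - a) > 0})"
proof (rule wedge_mono[OF assms(1) _ _ assms(2), of _ 1])
  have e: "{y. inner n (y - a) > 0} = {y. inner n y > inner n a}" by (auto simp: inner_diff_right)
  show "open {y. inner n (y - a) > 0}" "convex {y. inner n (y - a) > 0}"
    unfolding e by (auto simp: open_halfspace_gt convex_halfspace_gt)
  fix t :: real assume "0 < t"
  have "inner n (of_real t * (x - a)) = t * inner n (x - a)"
    by (metis inner_scaleR_right scaleR_conv_of_real)
  then show "a + of_real t * (x - a) \<in> {y. 0 < inner n (y - a)}"
    using \<open>0 < t\<close> assms(3) by simp
qed auto

lemma wedge_ray:
  assumes C: "wedge a C" and c: "c \<in> C" and x: "x \<in> C" and perp: "inner (\<i> * (c - a)) (x - a) = 0"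
  obtains t where "t > 0" "x = a + of_real t * (c - a)"
proof -
  have ca: "c \<noteq> a" "a \<notin> C" "convex C" using c C unfolding wedge_def by auto
  define z where "z = c - a"
  define y where "y = x - a"
  have z: "z \<noteq> 0" using ca by (simp add: z_def)
  have "Im (y * cnj z) = 0" using perp by (simp add: inner_complex_def z_def[symmetric] y_def[symmetric] algebra_simps)
  then have r: "y * cnj z = of_real (Re (y * cnj z))" by (simp add: complex_eq_iff)
  define t where "t = Re (y * cnj z) / (norm z)^2"
  have "y * (cnj z * z) = of_real (Re (y * cnj z)) * z" by (metis r mult.assoc)
  moreover have "cnj z * z = of_real ((norm z)^2)" by (metis complex_norm_square mult.commute of_real_power)
  ultimately have "y * of_real ((norm z)^2) = of_real (Re (y * cnj z)) * z" by simp
  then have y: "y = of_real t * z" unfolding t_def using z by (simp add: field_simps)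
  have x: "x = a + of_real t * (c - a)" using y by (simp add: y_def z_def algebra_simps)
  have "t > 0"
  proof (rule ccontr)
    assume "\<not> t > 0"
    then have t: "t \<le> 0" by simp
    define u where "u = - t / (1 - t)"
    have u: "0 \<le> u" "u \<le> 1" using t by (auto simp: u_def field_simps)
    have "(1 - u) *\<^sub>R x + u *\<^sub>R c \<in> C" using ca(3) \<open>x \<in> C\<close> c u unfolding convex_alt by blast
    moreover have "(1 - u) *\<^sub>R x + u *\<^sub>R c = a + of_real ((1 - u) * t + u) * (c - a)"
      unfolding x by (simp add: scaleR_conv_of_real algebra_simps)
    moreover have "(1 - u) * t + u = 0" using t by (simp add: u_def field_simps)
    ultimately show False using ca by simp
  qed
  then show ?thesis using that x by blast
qed

section \<open>Arcs do not separate wedges\<close>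

lemma wedge_segment:
  assumes "wedge a C" "c \<in> C" shows "closed_segment a c - {a} \<subseteq> C"
proof -
  have "open_segment c a \<subseteq> C"
    using in_interior_closure_convex_segment[of C c a] assms by (simp add: interior_open wedge_def)
  then show ?thesis using assms(2) closed_segment_eq_open[of a c] by (auto simp: open_segment_commute)
qed

lemma closed_segment_on_line:
  fixes a z :: complex
  assumes "s \<le> t"
  shows "closed_segment (a + of_real s * z) (a + of_real t * z) = (\<lambda>u. a + of_real u * z) ` {s..t}"
proof -
  have e: "(1 - u) *\<^sub>R (a + of_real s * z) + u *\<^sub>R (a + of_real t * z) =
      a + of_real ((1 - u) *\<^sub>R s + u *\<^sub>R t) * z" for u
    by (simp add: scaleR_conv_of_real algebra_simps)
  have *: "{s..t} = {(1 - u) *\<^sub>R s + u *\<^sub>R t |u. 0 \<le> u \<and> u \<le> 1}"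
    using assms closed_segment_eq_real_ivl[of s t] unfolding closed_segment_def by simp
  show ?thesis unfolding closed_segment_def e * by blast
qed

lemma connected_component_Diff:
  assumes "connected S" "S \<subseteq> U - F" "x \<in> S" "x \<in> connected_component_set (U - F) w"
  shows "S \<subseteq> connected_component_set (U - F) w"
  by (metis assms connected_component_eq connected_component_maximal)

text \<open>
  By Janiszewski's theorem, deleting from a component \<open>V\<close> of \<open>U\<close> all of \<open>F\<close> but a short straight piece at \<open>a\<close>
  leaves \<open>V\<close> connected. Hence every component of \<open>V - F\<close> comes close to that piece, and so contains one of the
  two half-wedges on its sides.
\<close>

lemma spokes_Diff:
  assumes U: "open U" "spokes a U" "a \<notin> U" "b \<notin> U"
    and C: "wedge a C" "C \<subseteq> U" "c \<in> C"
    and F: "F = closed_segment a c \<union> F'" "joins F' c b" "closed_segment a c \<inter> F' = {c}" "F' - {b} \<subseteq> U"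
  shows "spokes a (U - F)"
  unfolding spokes_def
proof
  fix w assume w: "w \<in> U - F"
  define V where "V = connected_component_set U c"
  have cU: "c \<in> U" using C by auto
  have V: "open V" "connected V" "V \<subseteq> U" "c \<in> V"
    unfolding V_def using U(1) cU by (auto simp: open_connected_component connected_component_subset)
  have CV: "C \<subseteq> V" unfolding V_def
    by (rule connected_component_maximal) (use C in \<open>auto simp: wedge_def convex_connected\<close>)
  have F'V: "F' - {b} \<subseteq> V" unfolding V_def
    using joins_connected(2)[OF F(2)] joins_ends[OF F(2)] F(4)
    by (intro connected_component_maximal) auto
  have segC: "closed_segment a c - {a} \<subseteq> C" using wedge_segment C by blast
  have FV: "F - {a, b} \<subseteq> V" using F'V segC CV F(1) by auto
  have caneq: "c \<noteq> a" using C U by auto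
  have aF': "a \<notin> F'" using F(3) caneq by (metis Int_iff ends_in_segment(1) singletonD)
  have clF: "closed F" "closed F'" using joins_compact[OF F(2)] F(1)
    by (auto simp: compact_imp_closed intro: closed_Un)
  show "\<exists>C. wedge a C \<and> C \<subseteq> connected_component_set (U - F) w"
  proof (cases "w \<in> V")
    case False
    then have disj: "connected_component_set U w \<inter> V = {}"
      unfolding V_def by (metis connected_component_disjoint connected_component_sym_eq mem_Collect_eq)
    have "connected_component_set U w \<subseteq> U - F"
      using disj FV U connected_component_subset[of U w] by blast
    then have "connected_component_set U w \<subseteq> connected_component_set (U - F) w"
      using w by (intro connected_component_maximal) auto
    moreover obtain D where "wedge a D" "D \<subseteq> connected_component_set U w"
      using U(2) w unfolding spokes_def by blast
    ultimately show ?thesis by blast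
  next
    case True
    obtain \<rho> where \<rho>: "\<rho> > 0" "ball a \<rho> \<inter> F' = {}"
      using clF(2) aF' by (metis open_contains_ball open_Compl Compl_iff disjoint_eq_subset_Compl)
    define r where "r = min \<rho> (norm (c - a) / 2)"
    have nca: "norm (c - a) > 0" using caneq by simp
    have r: "r > 0" "r < norm (c - a)" using \<rho> nca unfolding r_def by linarith+
    have rF': "ball a r \<inter> F' = {}" using \<rho>(2) unfolding r_def by auto
    define s where "s = r / norm (c - a)"
    have s: "0 < s" "s < 1" using r nca by (simp_all add: s_def)
    define c1 where "c1 = a + of_real s * (c - a)"
    define P where "P u = a + of_real u * (c - a)" for u
    have P: "P 0 = a" "P 1 = c" "P s = c1" by (auto simp: P_def c1_def)
    have Pinj: "P u = P v \<longleftrightarrow> u = v" for u v using caneq by (simp add: P_def)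
    have seg: "closed_segment a c = P ` {0..1}" "closed_segment c1 c = P ` {s..1}"
      using closed_segment_on_line[of 0 1 a "c - a"] closed_segment_on_line[of s 1 a "c - a"] s
      unfolding P_def[symmetric] P by auto
    have c1seg: "c1 \<in> closed_segment a c" "c1 \<noteq> c" "c1 \<noteq> a"
      using s Pinj[of s 1] Pinj[of s 0] unfolding seg P by (auto simp: P(3)[symmetric])
    have sub: "closed_segment c1 c \<subseteq> closed_segment a c" using c1seg by (simp add: subset_closed_segment)
    define F1 where "F1 = closed_segment c1 c \<union> F'"
    have jF1: "joins F1 c1 b" unfolding F1_def
      by (rule joins_Un[OF joins_segment F(2)]) (use c1seg sub F(3) in auto)
    have aF1: "a \<notin> closed_segment c1 c"
      unfolding seg P(1)[symmetric] using Pinj s by auto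
    have F1V: "F1 - {b} \<subseteq> V" unfolding F1_def using F'V sub aF1 segC CV by auto
    have con: "connected (V - F1)" using connected_Diff_arc[OF V(1,2) jF1 F1V] .
    define W where "W = connected_component_set (U - F) w"
    have oUF: "open (U - F)" using U(1) clF by auto
    have W: "open W" "connected W" "W \<subseteq> U - F" "w \<in> W"
      unfolding W_def using oUF w by (auto simp: open_connected_component connected_component_subset)
    have WV: "W \<subseteq> V"
    proof -
      have "W \<subseteq> connected_component_set U w" using W by (intro connected_component_maximal) auto
      then show ?thesis using True unfolding V_def by (metis connected_component_eq mem_Collect_eq)
    qed
    have key: "x \<in> C \<inter> ball a r" if x: "x \<in> F" "x \<in> V" "x \<notin> F1" for x
    proof -
      have xs: "x \<in> closed_segment a c" using x F(1) by (auto simp: F1_def)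
      then obtain u where u: "0 \<le> u" "u \<le> 1" "x = P u" unfolding seg by auto
      have "u < s" using x(3) u unfolding F1_def seg by force
      then have "dist a x < r" using u nca by (simp add: P_def dist_norm norm_mult s_def pos_less_divide_eq)
      moreover have "x \<in> C" using xs segC x(2) V(3) U(3) by auto
      ultimately show ?thesis by simp
    qed
    have "W \<inter> (C \<inter> ball a r) \<noteq> {}"
    proof
      assume empty: "W \<inter> (C \<inter> ball a r) = {}"
      define Z where "Z = \<Union>{connected_component_set (U - F) x | x. x \<in> V - F - W} \<union> (C \<inter> ball a r)"
      have "open Z" unfolding Z_def using oUF C
        by (auto simp: wedge_def intro!: open_Un open_Union open_connected_component open_Int)
      moreover have "W \<inter> Z = {}"
      proof -
        have "W \<inter> connected_component_set (U - F) x = {}" if "x \<notin> W" "x \<in> U - F" for x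
          using that unfolding W_def
          by (metis connected_component_disjoint mem_Collect_eq connected_component_sym)
        then show ?thesis using empty V(3) unfolding Z_def by blast
      qed
      moreover have "V - F1 \<subseteq> W \<union> Z"
      proof
        fix x assume x: "x \<in> V - F1"
        show "x \<in> W \<union> Z"
        proof (cases "x \<in> F")
          case True then show ?thesis using key x by (auto simp: Z_def)
        next
          case False
          have "x \<in> U - F" using x V False by auto
          then have "x \<in> connected_component_set (U - F) x" by auto
          then show ?thesis using False x unfolding Z_def by blast
        qed
      qed
      moreover have "w \<in> W \<inter> (V - F1)" using W(4) WV w F(1) sub by (auto simp: F1_def)
      moreover have "P (s/2) \<in> Z \<inter> (V - F1)"
      proof -
        have x: "P (s/2) \<in> closed_segment a c" unfolding seg using s by auto
        have "P (s/2) \<noteq> a" using s Pinj[of "s/2" 0] P by auto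
        then have xC: "P (s/2) \<in> C" using segC x by auto
        have "norm (of_real (s/2) * (c - a)) = r / 2" using nca r
          unfolding norm_mult norm_of_real by (simp add: s_def)
        then have xb: "P (s/2) \<in> ball a r" using r by (simp add: P_def dist_norm)
        have "P (s/2) \<notin> closed_segment c1 c" unfolding seg using s Pinj by auto
        then show ?thesis using xC xb CV rF' unfolding Z_def F1_def by blast
      qed
      ultimately show False using connectedD[OF con W(1)] by blast
    qed
    then obtain x where x: "x \<in> W" "x \<in> C" "x \<in> ball a r" by blast
    let ?n = "\<i> * (c - a)"
    have "inner ?n (x - a) \<noteq> 0"
    proof
      assume "inner ?n (x - a) = 0"
      then obtain t where t: "t > 0" "x = a + of_real t * (c - a)"
        using wedge_ray[OF C(1,3) x(2)] by blast
      have "t * norm (c - a) < norm (c - a)" using x(3) t r by (simp add: dist_norm norm_mult)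
      then have "t \<le> 1" using nca by simp
      then have "x \<in> F" using t F(1) unfolding seg P_def by auto
      then show False using x(1) W by auto
    qed
    then obtain n where n: "n = ?n \<or> n = - ?n" "inner n (x - a) > 0"
      by (metis inner_minus_left linorder_neqE_linordered_idom neg_0_less_iff_less)
    have perp: "inner n (y - a) = 0" if "y \<in> closed_segment a c" for y
    proof -
      from that obtain u where u: "y = P u" unfolding seg by auto
      have "inner (\<i> * z) (of_real u * z) = 0" for z by (simp add: inner_complex_def)
      then have "inner ?n (y - a) = 0" unfolding u P_def by simp
      then show ?thesis using n by (auto simp del: Im_i_times Re_i_times)
    qed
    define D where "D = (C \<inter> ball a r) \<inter> {y. inner n (y - a) > 0}"
    have D: "wedge a D" unfolding D_def by (rule wedge_halfplane[OF wedge_ball[OF C(1) r(1)]]) (use x n in auto)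
    have "D \<inter> F = {}" using F(1) rF' perp unfolding D_def by fastforce
    then have "D \<subseteq> U - F" using C unfolding D_def by auto
    then have "D \<subseteq> W" unfolding W_def
      using D x n by (intro connected_component_Diff[where x = x]) (auto simp: wedge_def convex_connected D_def W_def)
    then show ?thesis using D unfolding W_def by blast
  qed
qed

section \<open>Connecting points by arcs that start straight\<close>

lemma wedge_nonempty: "wedge a C \<Longrightarrow> \<exists>c. c \<in> C"
  unfolding wedge_def by (metis Diff_iff closure_empty empty_iff equals0I)

lemma joins_between:
  assumes M: "joins M x y" and S: "compact S" "compact T" "S \<inter> T = {}" "x \<in> S" "y \<in> T"
  obtains M' x' y' where "joins M' x' y'" "M' \<subseteq> M" "M' \<inter> S = {x'}" "M' \<inter> T = {y'}"
proof -
  obtain g where g: "arc g" "pathstart g = x" "pathfinish g = y" "path_image g = M"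
    using M unfolding joins_def by blast
  have inj: "inj_on g {0..1}" and cont: "continuous_on {0..1} g" using g(1) by (auto simp: arc_def path_def)
  have ends: "g 0 = x" "g 1 = y" "M = g ` {0..1}" using g by (auto simp: path_image_def pathstart_def pathfinish_def)
  have cl: "closed S" "closed T" using S by (auto simp: compact_imp_closed)
  define A where "A = {0..1} \<inter> g -` S"
  have A: "compact A" "0 \<in> A"
    unfolding A_def using continuous_closed_preimage[OF cont _ cl(1)] S(4) ends
    by (auto simp: compact_eq_bounded_closed bounded_Int)
  then obtain t1 where t1: "t1 \<in> A" "\<And>t. t \<in> A \<Longrightarrow> t \<le> t1"
    using compact_attains_sup[of A] by blast
  define B where "B = {t1..1} \<inter> g -` T"
  have "continuous_on {t1..1} g" using cont t1(1) by (auto simp: A_def intro: continuous_on_subset)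
  then have B: "compact B" "1 \<in> B"
    unfolding B_def using continuous_closed_preimage[OF _ _ cl(2), of "{t1..1}" g] S(5) ends t1(1)
    by (auto simp: A_def compact_eq_bounded_closed bounded_Int)
  then obtain t2 where t2: "t2 \<in> B" "\<And>t. t \<in> B \<Longrightarrow> t2 \<le> t"
    using compact_attains_inf[of B] by blast
  have t: "0 \<le> t1" "t1 \<le> t2" "t2 \<le> 1" "g t1 \<in> S" "g t2 \<in> T" using t1(1) t2(1) by (auto simp: A_def B_def)
  then have lt: "t1 < t2" using S(3) by (metis disjoint_iff less_eq_real_def)
  show ?thesis
  proof (rule that)
    show "joins (g ` {t1..t2}) (g t1) (g t2)" using joins_subpath[OF g(1)] t lt by auto
    show "g ` {t1..t2} \<subseteq> M" using t ends by auto
    have "t = t1" if "t \<in> {t1..t2}" "g t \<in> S" for t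
      using t1(2)[of t] that t by (simp add: A_def)
    then show "g ` {t1..t2} \<inter> S = {g t1}" using t by (auto simp del: atLeastAtMost_iff) auto
    have "t = t2" if "t \<in> {t1..t2}" "g t \<in> T" for t
      using t2(2)[of t] that t by (simp add: B_def)
    then show "g ` {t1..t2} \<inter> T = {g t2}" using t by (auto simp del: atLeastAtMost_iff) auto
  qed
qed

lemma joins_connected_open:
  assumes "open V" "connected V" "x \<in> V" "y \<in> V" "x \<noteq> y"
  obtains M where "joins M x y" "M \<subseteq> V"
proof -
  have "path_connected V" using assms connected_open_path_connected by blast
  then obtain g where "arc g" "path_image g \<subseteq> V" "pathstart g = x" "pathfinish g = y"
    using assms path_connected_arcwise by metis
  then show ?thesis using that unfolding joins_def by blast
qed

lemma arc_initial:
  fixes h :: "real \<Rightarrow> complex"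
  assumes "arc h" "r > 0"
  obtains t where "0 < t" "t \<le> 1" "h ` {0..t} \<subseteq> ball (h 0) r"
proof -
  have "continuous_on {0..1} h" using assms by (auto simp: arc_def path_def)
  then obtain \<delta> where \<delta>: "\<delta> > 0" "\<And>t. t \<in> {0..1} \<Longrightarrow> dist t 0 < \<delta> \<Longrightarrow> dist (h t) (h 0) < r"
    using assms(2) unfolding continuous_on_iff by (metis atLeastAtMost_iff order_refl zero_le_one)
  define t where "t = min (\<delta>/2) 1"
  have t: "0 < t" "t < \<delta>" "t \<le> 1" using \<delta> by (auto simp: t_def)
  have "h ` {0..t} \<subseteq> ball (h 0) r" using \<delta>(2) t by (force simp: dist_commute)
  then show ?thesis using that t by blast
qed

lemma joins_initial:
  assumes "joins H b d" "r > 0"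
  obtains H' d' where "joins H' b d'" "H' \<subseteq> H" "H' \<subseteq> ball b r"
proof -
  obtain h where h: "arc h" "h 0 = b" "H = h ` {0..1}"
    using assms(1) unfolding joins_def path_image_def pathstart_def by blast
  obtain t where t: "0 < t" "t \<le> 1" "h ` {0..t} \<subseteq> ball (h 0) r" using arc_initial[OF h(1) assms(2)] .
  have "h ` {0..t} \<subseteq> H" using t h by auto
  then show ?thesis using that[of "h ` {0..t}" "h t"] joins_subpath[OF h(1), of 0 t] t h by auto
qed

lemma joins_through:
  assumes V: "open V" "connected V" "a \<notin> V" "b \<notin> V" "a \<noteq> b"
    and C: "wedge a C" "C \<subseteq> V" and h: "arc h" "h 0 = b" "h ` {0<..1} \<subseteq> V"
  obtains c s M where "c \<in> C" "0 < s" "s \<le> 1" "joins M c (h s)" "M \<subseteq> V"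
    "closed_segment a c \<inter> M = {c}" "M \<inter> h ` {0..s} = {h s}" "closed_segment a c \<inter> h ` {0..s} = {}"
proof -
  define r where "r = dist a b / 2"
  have r: "r > 0" using V(5) unfolding r_def by simp
  have r2: "ball a r \<inter> ball b r = {}" unfolding r_def
    by (rule disjoint_ballI) simp
  have "wedge a (C \<inter> ball a r)" using wedge_ball[OF C(1) r(1)] .
  then obtain c0 where c0: "c0 \<in> C" "c0 \<in> ball a r" using wedge_nonempty by blast
  have seg: "closed_segment a c0 \<subseteq> ball a r" using c0 r by (simp add: closed_segment_subset)
  have segC: "closed_segment a c0 - {a} \<subseteq> C" using wedge_segment[OF C(1) c0(1)] .
  obtain t0 where t0: "0 < t0" "t0 \<le> 1" and H0: "h ` {0..t0} \<subseteq> ball b r"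
    using arc_initial[OF h(1) r] h(2) by auto
  have jH0: "compact (h ` {0..t0})" using joins_subpath[OF h(1), of 0 t0] t0 joins_compact by auto
  have "c0 \<in> V" "h t0 \<in> V" using c0 C h t0 by auto
  moreover have "h t0 \<in> ball b r" using H0 t0 by (meson atLeastAtMost_iff image_subset_iff less_eq_real_def)
  then have "c0 \<noteq> h t0" using c0(2) r2 by blast
  ultimately obtain M0 where M0: "joins M0 c0 (h t0)" "M0 \<subseteq> V" using joins_connected_open[OF V(1,2)] by metis
  have disj: "closed_segment a c0 \<inter> h ` {0..t0} = {}" using seg H0 r2 by blast
  obtain M c e where M: "joins M c e" "M \<subseteq> M0" "M \<inter> closed_segment a c0 = {c}" "M \<inter> h ` {0..t0} = {e}"
    by (rule joins_between[OF M0(1) _ jH0 disj]) (use t0 in auto)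
  then have "e \<in> h ` {0..t0}" by blast
  then obtain s where s: "e = h s" "0 \<le> s" "s \<le> t0" by auto
  have "s \<noteq> 0" using s M M0(2) V(4) h(2) by auto
  then have s0: "s > 0" using s by simp
  have ca: "c \<in> closed_segment a c0" "c \<noteq> a" using M M0(2) V by auto
  have sub: "closed_segment a c \<subseteq> closed_segment a c0" using ca by (simp add: subset_closed_segment)
  show ?thesis
  proof (rule that)
    show "c \<in> C" using ca segC by auto
    show "0 < s" "s \<le> 1" "joins M c (h s)" "M \<subseteq> V" using M M0 s0 s t0 by auto
    show "closed_segment a c \<inter> M = {c}" using sub M(3) by auto
    show "M \<inter> h ` {0..s} = {h s}" using M(4) s by auto
    show "closed_segment a c \<inter> h ` {0..s} = {}" using sub disj s by auto
  qed
qed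

lemma spokes_add_leg:
  assumes U: "open U" "spokes a U" "a \<notin> U" "b \<notin> U" "a \<noteq> b" and H: "joins H b d" "H - {b} \<subseteq> U"
  obtains F c r where "joins F a b" "F - {a, b} \<subseteq> U" "spokes a (U - F)" "c \<noteq> a" "closed_segment a c \<subseteq> F"
    "r > 0" "F \<inter> ball a r \<subseteq> closed_segment a c"
proof -
  have d: "d \<in> H" "d \<noteq> b" using joins_ends[OF H(1)] by auto
  then have dU: "d \<in> U" using H by auto
  define V where "V = connected_component_set U d"
  have V: "open V" "connected V" "V \<subseteq> U" "d \<in> V"
    unfolding V_def using U(1) dU by (auto simp: open_connected_component connected_component_subset)
  have HV: "H - {b} \<subseteq> V" unfolding V_def
    using joins_connected(1)[OF H(1)] d H by (intro connected_component_maximal) auto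
  obtain C where C: "wedge a C" "C \<subseteq> V" using U(2) dU unfolding spokes_def V_def by blast
  obtain h where h: "arc h" "h 0 = b" "H = h ` {0..1}"
    using H(1) unfolding joins_def path_image_def pathstart_def by blast
  have inj: "inj_on h {0..1}" using h(1) by (simp add: arc_def)
  have "h t \<noteq> b" if "t \<in> {0<..1}" for t using inj_onD[OF inj, of 0 t] that h(2) by auto
  then have hV: "h ` {0<..1} \<subseteq> V" using HV h(3) by force
  have ab: "a \<notin> V" "b \<notin> V" using U V by auto
  obtain c s M where c: "c \<in> C" "0 < s" "s \<le> 1" "joins M c (h s)" "M \<subseteq> V"
    "closed_segment a c \<inter> M = {c}" "M \<inter> h ` {0..s} = {h s}" "closed_segment a c \<inter> h ` {0..s} = {}"
    by (rule joins_through[OF V(1,2) ab U(5) C h(1,2) hV])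
  define e where "e = h s"
  define H' where "H' = h ` {0..s}"
  have "joins H' e b" using joins_sym[OF joins_subpath[OF h(1), of 0 s]] c h(2) by (simp add: H'_def e_def)
  moreover have "H' \<subseteq> H" using c h by (auto simp: H'_def)
  ultimately have *: "c \<in> C" "joins M c e" "M \<subseteq> V" "joins H' e b" "H' \<subseteq> H"
    "closed_segment a c \<inter> M = {c}" "M \<inter> H' = {e}" "closed_segment a c \<inter> H' = {}"
    using c by (auto simp: e_def H'_def)
  define F' where "F' = M \<union> H'"
  have F': "joins F' c b" unfolding F'_def using joins_Un[OF *(2,4)] * by auto
  have int: "closed_segment a c \<inter> F' = {c}" using * by (auto simp: F'_def)
  have F'U: "F' - {b} \<subseteq> U" using * V HV by (auto simp: F'_def)
  have ca: "c \<noteq> a" using * C U V by auto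
  define F where "F = closed_segment a c \<union> F'"
  have "a \<notin> F'" using int ca by (metis Int_iff ends_in_segment(1) singletonD)
  then obtain r where r: "r > 0" "ball a r \<subseteq> - F'"
    using joins_compact[OF F'] by (metis compact_imp_closed open_Compl open_contains_ball Compl_iff)
  show ?thesis
  proof (rule that)
    show "joins F a b" unfolding F_def using joins_Un[OF joins_segment[OF ca[symmetric]] F'] int by auto
    have "closed_segment a c - {a} \<subseteq> C" using wedge_segment[OF C(1) *(1)] .
    then show "F - {a, b} \<subseteq> U" using F'U C V unfolding F_def by blast
    show "spokes a (U - F)" by (rule spokes_Diff[OF U(1-4) C(1) _ *(1) F_def F' int F'U]) (use C V in auto)
    show "F \<inter> ball a r \<subseteq> closed_segment a c" using r by (auto simp: F_def)
  qed (use ca r F_def in auto)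
qed

lemma spokes_join:
  assumes V: "open V" "connected V" "a \<notin> V" "b \<notin> V" "a \<noteq> b"
    and C: "wedge a C" "C \<subseteq> V" and D: "wedge b D" "D \<subseteq> V"
  obtains F where "joins F a b" "F - {a, b} \<subseteq> V" "spokes a (V - F)" "spokes b (V - F)"
proof -
  obtain d where d: "d \<in> D" using D unfolding wedge_def by fastforce
  have db: "d \<noteq> b" using d D V by auto
  have segD: "closed_segment b d - {b} \<subseteq> D" using wedge_segment[OF D(1) d] .
  have sp: "spokes a V" "spokes b V" unfolding spokes_def using C D connected_component_eq_self[OF V(2)] by blast+
  define h where "h = linepath b d"
  have h_eq: "h = (\<lambda>t. b + of_real t * (d - b))"
    unfolding h_def linepath_def by (simp add: scaleR_conv_of_real algebra_simps)
  have hseg: "h ` {0..s} = closed_segment b (h s)" if "0 \<le> s" for s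
    using closed_segment_on_line[of 0 s b "d - b"] that unfolding h_eq by simp
  have h: "arc h" "h 0 = b" unfolding h_def using db[symmetric] arc_linepath by (auto simp: linepath_def)
  have "h ` {0<..1} \<subseteq> closed_segment b d - {b}"
    using hseg[of 1] db by (auto simp: h_eq)
  then have hV: "h ` {0<..1} \<subseteq> V" using segD D by blast
  obtain c s M where c: "c \<in> C" "0 < s" "s \<le> 1" "joins M c (h s)" "M \<subseteq> V"
    "closed_segment a c \<inter> M = {c}" "M \<inter> h ` {0..s} = {h s}" "closed_segment a c \<inter> h ` {0..s} = {}"
    by (rule joins_through[OF V C h hV])
  define e where "e = h s"
  have eb: "e \<noteq> b" using c db by (simp add: e_def h_eq)
  have "e \<in> h ` {0..1}" using c by (auto simp: e_def)
  then have e: "e \<in> closed_segment b d" using hseg[of 1] by (simp add: h_eq)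
  have *: "c \<in> C" "joins M c e" "M \<subseteq> V" "joins (closed_segment b e) e b" "closed_segment b e \<subseteq> closed_segment b d"
    "closed_segment a c \<inter> M = {c}" "M \<inter> closed_segment b e = {e}" "closed_segment a c \<inter> closed_segment b e = {}"
    using c e hseg[of s] joins_sym[OF joins_segment[OF eb[symmetric]]] by (auto simp: e_def subset_closed_segment)
  have eD: "e \<in> D" using e eb segD by auto
  have segC: "closed_segment a c - {a} \<subseteq> C" using wedge_segment[OF C(1) *(1)] .
  have ca: "c \<noteq> a" using * C V by auto
  define F where "F = closed_segment a c \<union> (M \<union> closed_segment b e)"
  have F2: "F = closed_segment b e \<union> (M \<union> closed_segment a c)" unfolding F_def by auto
  have j1: "joins (M \<union> closed_segment b e) c b" using joins_Un[OF *(2,4)] * by auto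
  have j2: "joins (M \<union> closed_segment a c) e a"
    using joins_Un[OF joins_sym[OF *(2)] joins_sym[OF joins_segment[OF ca[symmetric]]]] * by auto
  show ?thesis
  proof (rule that)
    show "joins F a b" unfolding F_def using joins_Un[OF joins_segment[OF ca[symmetric]] j1] *(6,8) by (simp add: Int_Un_distrib)
    show "F - {a, b} \<subseteq> V" unfolding F_def using segC segD *(3,5) C(2) D(2) by auto
    show "spokes a (V - F)"
      by (rule spokes_Diff[OF V(1) sp(1) V(3,4) C *(1) F_def j1]) (use segD * D in auto)
    show "spokes b (V - F)"
      by (rule spokes_Diff[OF V(1) sp(2) V(4,3) D eD F2 j2]) (use segC * C in auto)
  qed
qed

section \<open>Spiders and triangles\<close>

definition straight :: "complex \<Rightarrow> complex set \<Rightarrow> bool" where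
  "straight m F \<longleftrightarrow> (\<exists>c r. c \<noteq> m \<and> r > 0 \<and> closed_segment m c \<subseteq> F \<and> F \<inter> ball m r \<subseteq> closed_segment m c)"

lemma spokes_punctured:
  assumes "open R" "connected R" "m \<in> R" shows "spokes m (R - {m})"
proof -
  obtain r where r: "r > 0" "ball m r \<subseteq> R" using assms by (meson open_contains_ball)
  define C where "C = ball m r \<inter> {y. inner 1 (y - m) > 0}"
  have e: "{y. inner 1 (y - m) > 0} = {y. inner 1 y > inner 1 m}" by (auto simp: inner_diff_right)
  have "m \<in> closure C" unfolding closure_approachable
  proof (intro allI impI)
    fix \<epsilon> :: real assume "\<epsilon> > 0"
    define s where "s = min r \<epsilon> / 2"
    have s: "0 < s" "s < r" "s < \<epsilon>" using r \<open>\<epsilon> > 0\<close> by (auto simp: s_def)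
    have "m + of_real s \<in> C" using s unfolding C_def by (simp add: dist_norm)
    moreover have "dist (m + of_real s) m < \<epsilon>" using s by (simp add: dist_norm)
    ultimately show "\<exists>y\<in>C. dist y m < \<epsilon>" by blast
  qed
  moreover have "open C" "convex C" unfolding C_def e
    by (intro open_Int convex_Int open_halfspace_gt convex_halfspace_gt open_ball convex_ball)+
  moreover have "m \<notin> C" by (simp add: C_def)
  ultimately have C: "wedge m C" unfolding wedge_def by blast
  have "C \<subseteq> R - {m}" using r C unfolding C_def wedge_def by auto
  moreover have "connected (R - {m})" using connected_open_delete[of R m] assms by simp
  ultimately show ?thesis unfolding spokes_def using C connected_component_eq_self by metis
qed

lemma spider:
  assumes R: "open R" "connected R" "m \<in> R" and T: "finite T"
    and ports: "\<And>x. x \<in> T \<Longrightarrow> x \<notin> R \<and> (\<exists>H d. joins H x d \<and> H - {x} \<subseteq> R - {m})"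
  obtains L where "\<And>x. x \<in> T \<Longrightarrow> joins (L x) m x \<and> L x - {x} \<subseteq> R \<and> straight m (L x)"
    "\<And>x y. x \<in> T \<Longrightarrow> y \<in> T \<Longrightarrow> x \<noteq> y \<Longrightarrow> L x \<inter> L y = {m}"
proof -
  have "\<exists>L. (\<forall>x\<in>T. joins (L x) m x \<and> L x - {x} \<subseteq> R \<and> straight m (L x)) \<and>
      (\<forall>x\<in>T. \<forall>y\<in>T. x \<noteq> y \<longrightarrow> L x \<inter> L y = {m}) \<and> spokes m (R - {m} - \<Union>(L ` T))"
    using T ports
  proof (induction T rule: finite_induct)
    case empty
    then show ?case using spokes_punctured[OF R] by simp
  next
    case (insert x S)
    have "\<exists>L. (\<forall>x\<in>S. joins (L x) m x \<and> L x - {x} \<subseteq> R \<and> straight m (L x)) \<and>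
      (\<forall>x\<in>S. \<forall>y\<in>S. x \<noteq> y \<longrightarrow> L x \<inter> L y = {m}) \<and> spokes m (R - {m} - \<Union>(L ` S))"
      by (rule insert.IH, rule insert.prems, rule insertI2)
    then obtain L where L0: "(\<forall>x\<in>S. joins (L x) m x \<and> L x - {x} \<subseteq> R \<and> straight m (L x)) \<and>
      (\<forall>x\<in>S. \<forall>y\<in>S. x \<noteq> y \<longrightarrow> L x \<inter> L y = {m}) \<and> spokes m (R - {m} - \<Union>(L ` S))"
      by (rule exE)
    note L = L0[THEN conjunct1, rule_format] L0[THEN conjunct2, THEN conjunct1, rule_format]
    note L3 = L0[THEN conjunct2, THEN conjunct2]
    define K where "K = \<Union>(L ` S)"
    define U where "U = R - {m} - K"
    have K: "closed K" unfolding K_def using L(1) joins_compact compact_imp_closed insert.hyps(1)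
      by (intro closed_Union) blast+
    have x: "x \<notin> R" using insert.prems by blast
    then have xK: "x \<notin> K" unfolding K_def using L(1) insert.hyps(2) by blast
    obtain H0 d0 where H0: "joins H0 x d0" "H0 - {x} \<subseteq> R - {m}" using insert.prems by blast
    obtain r where r: "r > 0" "ball x r \<subseteq> - K" using K xK by (metis ComplI open_Compl open_contains_ball)
    obtain H d where H: "joins H x d" "H \<subseteq> H0" "H \<subseteq> ball x r" using joins_initial[OF H0(1) r(1)] .
    have HU: "H - {x} \<subseteq> U" using H H0 r unfolding U_def by blast
    have U: "open U" "spokes m U" "m \<notin> U" "x \<notin> U" "m \<noteq> x"
      using R K L3 x unfolding U_def K_def[symmetric] by (auto simp: open_Diff)
    obtain F c \<rho> where F: "joins F m x" "F - {m, x} \<subseteq> U" "spokes m (U - F)" "c \<noteq> m" "closed_segment m c \<subseteq> F"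
      "\<rho> > 0" "F \<inter> ball m \<rho> \<subseteq> closed_segment m c"
      by (rule spokes_add_leg[OF U H(1) HU])
    have FL: "F \<inter> L y = {m}" if "y \<in> S" for y
    proof -
      have "L y \<subseteq> K" using that by (auto simp: K_def)
      then have "F \<inter> L y \<subseteq> {m}" using F(2) xK unfolding U_def by blast
      moreover have "m \<in> F" "m \<in> L y" using joins_ends F(1) L(1)[OF that] by blast+
      ultimately show ?thesis by blast
    qed
    have xS: "x \<notin> S" using insert.hyps by blast
    let ?L = "L(x := F)"
    have "\<forall>y\<in>insert x S. joins (?L y) m y \<and> ?L y - {y} \<subseteq> R \<and> straight m (?L y)"
      using L(1) F R(3) xS unfolding straight_def U_def by auto
    moreover have "\<forall>y\<in>insert x S. \<forall>z\<in>insert x S. y \<noteq> z \<longrightarrow> ?L y \<inter> ?L z = {m}"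
      using FL L(2) xS by (auto simp: Int_commute)
    moreover have "R - {m} - \<Union>(?L ` insert x S) = U - F"
      using xS unfolding U_def K_def by auto
    ultimately show ?case using F(3) by metis
  qed
  then obtain L where L: "(\<forall>x\<in>T. joins (L x) m x \<and> L x - {x} \<subseteq> R \<and> straight m (L x)) \<and>
      (\<forall>x\<in>T. \<forall>y\<in>T. x \<noteq> y \<longrightarrow> L x \<inter> L y = {m}) \<and> spokes m (R - {m} - \<Union>(L ` T))"
    by (rule exE)
  show ?thesis by (rule that[of L]) (use L in simp_all)
qed

lemma wedge_avoid:
  assumes "wedge a C" "closed K" "a \<notin> K" obtains D where "wedge a D" "D \<subseteq> C - K"
proof -
  obtain r where "r > 0" "ball a r \<subseteq> - K" using assms by (metis ComplI open_Compl open_contains_ball)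
  then show ?thesis using that[OF wedge_ball[OF assms(1)], of r] by blast
qed

lemma triangle:
  assumes U: "open U" "connected U" and a: "a \<notin> U" "b \<notin> U" "c \<notin> U" "a \<noteq> b" "b \<noteq> c" "a \<noteq> c"
    and A: "wedge a A" "A \<subseteq> U" and B: "wedge b B" "B \<subseteq> U" and C: "wedge c C" "C \<subseteq> U"
  obtains F G H where "joins F a b" "joins G b c" "joins H a c"
    "F - {a, b} \<subseteq> U" "G - {b, c} \<subseteq> U" "H - {a, c} \<subseteq> U"
    "F \<inter> G \<subseteq> {b}" "F \<inter> H \<subseteq> {a}" "G \<inter> H \<subseteq> {c}"
proof -
  obtain F where F: "joins F a b" "F - {a, b} \<subseteq> U" "spokes a (U - F)" "spokes b (U - F)"
    using spokes_join[OF U a(1,2,4) A B] .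
  have clF: "closed F" using joins_compact[OF F(1)] by (simp add: compact_imp_closed)
  have cF: "c \<notin> F" using F(2) a by auto
  obtain C' where C': "wedge c C'" "C' \<subseteq> C - F" using wedge_avoid[OF C(1) clF cF] .
  obtain w where w: "w \<in> C'" using wedge_nonempty[OF C'(1)] by blast
  define W where "W = connected_component_set (U - F) w"
  have wUF: "w \<in> U - F" using w C' C by auto
  have W: "open W" "connected W" "W \<subseteq> U - F"
    unfolding W_def using U clF by (auto simp: open_connected_component open_Diff connected_component_subset)
  have C'W: "C' \<subseteq> W" unfolding W_def
    using C' C w by (intro connected_component_maximal) (auto simp: wedge_def convex_connected)
  obtain A' where A': "wedge a A'" "A' \<subseteq> W" using F(3) wUF unfolding spokes_def W_def by blast
  obtain B' where B': "wedge b B'" "B' \<subseteq> W" using F(4) wUF unfolding spokes_def W_def by blast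
  have aW: "a \<notin> W" "b \<notin> W" "c \<notin> W" using W a by auto
  obtain H where H: "joins H a c" "H - {a, c} \<subseteq> W" "spokes c (W - H)"
    using spokes_join[OF W(1,2) aW(1,3) a(6) A' C'(1) C'W] by blast
  have clH: "closed H" using joins_compact[OF H(1)] by (simp add: compact_imp_closed)
  have bH: "b \<notin> H" using H(2) aW a by auto
  obtain B'' where B'': "wedge b B''" "B'' \<subseteq> B' - H" using wedge_avoid[OF B'(1) clH bH] .
  obtain v where v: "v \<in> B''" using wedge_nonempty[OF B''(1)] by blast
  define V where "V = connected_component_set (W - H) v"
  have vWH: "v \<in> W - H" using v B'' B' by auto
  have V: "open V" "connected V" "V \<subseteq> W - H"
    unfolding V_def using W clH by (auto simp: open_connected_component open_Diff connected_component_subset)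
  have B''V: "B'' \<subseteq> V" unfolding V_def
    using B'' B' v by (intro connected_component_maximal) (auto simp: wedge_def convex_connected)
  obtain C'' where C'': "wedge c C''" "C'' \<subseteq> V" using H(3) vWH unfolding spokes_def V_def by blast
  have bV: "b \<notin> V" "c \<notin> V" using V aW by auto
  obtain G where G: "joins G b c" "G - {b, c} \<subseteq> V"
    using spokes_join[OF V(1,2) bV a(5) B''(1) B''V C''] by blast
  show ?thesis
  proof (rule that[OF F(1) G(1) H(1) F(2)])
    show "G - {b, c} \<subseteq> U" "H - {a, c} \<subseteq> U" using G(2) H(2) V W by blast+
    show "F \<inter> G \<subseteq> {b}" using G(2) V W cF by blast
    show "F \<inter> H \<subseteq> {a}" using H(2) W cF by blast
    show "G \<inter> H \<subseteq> {c}" using G(2) V bH by blast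
  qed
qed

lemma complete_graph_drawing:
  fixes q :: "'a \<Rightarrow> complex"
  assumes U: "open U" "connected U" and N: "finite N" "card N \<le> 3" "inj_on q N"
    and w: "\<And>v. v \<in> N \<Longrightarrow> q v \<notin> U \<and> (\<exists>C. wedge (q v) C \<and> C \<subseteq> U)"
  obtains f where "\<And>u v. u \<in> N \<Longrightarrow> v \<in> N \<Longrightarrow> u \<noteq> v \<Longrightarrow> joins (f {u, v}) (q u) (q v) \<and> f {u, v} - {q u, q v} \<subseteq> U"
    "\<And>u v x y. u \<in> N \<Longrightarrow> v \<in> N \<Longrightarrow> x \<in> N \<Longrightarrow> y \<in> N \<Longrightarrow> u \<noteq> v \<Longrightarrow> x \<noteq> y \<Longrightarrow> {u, v} \<noteq> {x, y} \<Longrightarrow>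
       f {u, v} \<inter> f {x, y} \<subseteq> q ` ({u, v} \<inter> {x, y})"
proof -
  consider "card N \<le> 1" | "card N = 2" | "card N = 3" using N(2) by linarith
  then show ?thesis
  proof cases
    case 1
    then have "u = v" if "u \<in> N" "v \<in> N" for u v using N(1) that card_le_Suc0_iff_eq[of N] by auto
    then show ?thesis using that[of "\<lambda>_. {}"] by metis
  next
    case 2
    then obtain u v where uv: "N = {u, v}" "u \<noteq> v" by (meson card_2_iff)
    then have q: "q u \<noteq> q v" using N(3) by auto
    obtain C D where "wedge (q u) C" "C \<subseteq> U" "wedge (q v) D" "D \<subseteq> U" using w[of u] w[of v] uv by auto
    then obtain F where F: "joins F (q u) (q v)" "F - {q u, q v} \<subseteq> U"
      using spokes_join[OF U _ _ q] w uv by (metis insert_iff)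
    show ?thesis
    proof (rule that[of "\<lambda>_. F"])
      fix x y assume "x \<in> N" "y \<in> N" "x \<noteq> y"
      then consider "x = u \<and> y = v" | "x = v \<and> y = u" using uv by auto
      then show "joins F (q x) (q y) \<and> F - {q x, q y} \<subseteq> U"
        by cases (use F joins_sym[OF F(1)] in \<open>auto simp: insert_commute\<close>)
    qed (use uv in auto)
  next
    case 3
    then obtain u v x where uvx: "N = {u, v, x}" "u \<noteq> v" "v \<noteq> x" "u \<noteq> x" by (auto simp: card_3_iff)
    then have q: "q u \<noteq> q v" "q v \<noteq> q x" "q u \<noteq> q x" using N(3) by auto
    obtain A B C where ABC: "wedge (q u) A" "A \<subseteq> U" "wedge (q v) B" "B \<subseteq> U" "wedge (q x) C" "C \<subseteq> U"
      using w[of u] w[of v] w[of x] uvx by auto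
    have nU: "q u \<notin> U" "q v \<notin> U" "q x \<notin> U" using w uvx by auto
    obtain F G H where *: "joins F (q u) (q v)" "joins G (q v) (q x)" "joins H (q u) (q x)"
      "F - {q u, q v} \<subseteq> U" "G - {q v, q x} \<subseteq> U" "H - {q u, q x} \<subseteq> U"
      "F \<inter> G \<subseteq> {q v}" "F \<inter> H \<subseteq> {q u}" "G \<inter> H \<subseteq> {q x}"
      by (rule triangle[OF U nU q ABC])
    define f where "f e = (if e = {u, v} then F else if e = {v, x} then G else H)" for e
    have f: "f {u, v} = F" "f {v, u} = F" "f {v, x} = G" "f {x, v} = G" "f {u, x} = H" "f {x, u} = H"
      using uvx by (auto simp: f_def doubleton_eq_iff)
    show ?thesis
    proof (rule that[of f])
      fix y z assume "y \<in> N" "z \<in> N" "y \<noteq> z"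
      then consider "y = u \<and> z = v" | "y = v \<and> z = u" | "y = u \<and> z = x" | "y = x \<and> z = u"
        | "y = v \<and> z = x" | "y = x \<and> z = v" using uvx by auto
      then show "joins (f {y, z}) (q y) (q z) \<and> f {y, z} - {q y, q z} \<subseteq> U"
        by cases (use * joins_sym[OF *(1)] joins_sym[OF *(2)] joins_sym[OF *(3)] f in \<open>auto simp: insert_commute\<close>)
    next
      fix y z y' z' assume yz: "y \<in> N" "z \<in> N" "y' \<in> N" "z' \<in> N" "y \<noteq> z" "y' \<noteq> z'" "{y, z} \<noteq> {y', z'}"
      have e: "{y, z} = {u, v} \<or> {y, z} = {v, x} \<or> {y, z} = {u, x}" if "y \<in> N" "z \<in> N" "y \<noteq> z" for y z
        using that uvx by auto
      have i: "{u, v} \<inter> {v, x} = {v}" "{u, v} \<inter> {u, x} = {u}" "{v, x} \<inter> {u, x} = {x}" using uvx by auto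
      have i': "{v, x} \<inter> {u, v} = {v}" "{u, x} \<inter> {u, v} = {u}" "{u, x} \<inter> {v, x} = {x}" using uvx by auto
      show "f {y, z} \<inter> f {y', z'} \<subseteq> q ` ({y, z} \<inter> {y', z'})"
        using e[OF yz(1,2,5)] e[OF yz(3,4,6)] yz(7)
        by (elim disjE; simp only: f i i'; (simp; fail | use *(7,8,9) in auto))
    qed
  qed
qed

section \<open>Collars\<close>

text \<open>
  The factor 1/2 makes the collars of two sets disjoint as soon as each set belongs to the other's obstacle.
\<close>

definition collar :: "complex set \<Rightarrow> complex set \<Rightarrow> complex set" where
  "collar X Y = (\<Union>y \<in> Y - X. ball y (infdist y X / 2))"

lemma open_collar: "open (collar X Y)"
  unfolding collar_def by auto

lemma collar_superset:
  assumes "closed X" "X \<noteq> {}" shows "Y - X \<subseteq> collar X Y"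
proof
  fix y assume y: "y \<in> Y - X"
  then have "infdist y X > 0" using infdist_pos_not_in_closed[of X y] assms by auto
  then show "y \<in> collar X Y" using y unfolding collar_def by force
qed

lemma collar_disjoint: "collar X Y \<inter> X = {}"
proof -
  have "dist y x \<ge> infdist y X / 2" if "x \<in> X" for x y
    using infdist_le[OF that, of y] infdist_nonneg[of y X] by linarith
  then have "x \<notin> collar X Y" if "x \<in> X" for x
    using that unfolding collar_def by (auto simp: not_less)
  then show ?thesis by blast
qed

lemma collars_disjoint:
  assumes "Y \<subseteq> X'" "Y' \<subseteq> X" shows "collar X Y \<inter> collar X' Y' = {}"
proof -
  have False if "z \<in> collar X Y" "z \<in> collar X' Y'" for z
  proof -
    from that obtain y where y: "y \<in> Y" "dist y z < infdist y X / 2" unfolding collar_def by auto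
    from that obtain y' where y': "y' \<in> Y'" "dist y' z < infdist y' X' / 2" unfolding collar_def by auto
    have "infdist y X \<le> dist y y'" "infdist y' X' \<le> dist y' y"
      using infdist_le[of y' X y] infdist_le[of y X' y'] y y' assms by auto
    moreover have "dist y y' \<le> dist y z + dist y' z" by (metis dist_triangle2)
    ultimately show False using y y' by (simp add: dist_commute)
  qed
  then show ?thesis by blast
qed

lemma connected_collar:
  assumes "closed X" "X \<noteq> {}" "connected (Y - X)" shows "connected (collar X Y)"
proof (cases "Y - X = {}")
  case True then show ?thesis unfolding collar_def by (simp only: UN_empty connected_empty)
next
  case False
  then obtain z where z: "z \<in> Y - X" by blast
  have "connected (\<Union>y\<in>Y - X. ball y (infdist y X / 2) \<union> (Y - X))"
  proof (rule connected_Union)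
    fix S assume "S \<in> (\<lambda>y. ball y (infdist y X / 2) \<union> (Y - X)) ` (Y - X)"
    then obtain y where y: "y \<in> Y - X" "S = ball y (infdist y X / 2) \<union> (Y - X)" by blast
    have "infdist y X > 0" using infdist_pos_not_in_closed[of X y] assms y by auto
    then have "y \<in> ball y (infdist y X / 2) \<inter> (Y - X)" using y by simp
    then show "connected S" unfolding y(2)
      by (intro connected_Un[OF convex_connected[OF convex_ball] assms(3)]) blast
  qed (use z in blast)
  moreover have "(\<Union>y\<in>Y - X. ball y (infdist y X / 2) \<union> (Y - X)) = collar X Y"
    using collar_superset[OF assms(1,2), of Y] unfolding collar_def by blast
  ultimately show ?thesis by simp
qed

lemma ray_separation:
  fixes u v :: complex
  assumes "u \<noteq> 0" "v \<noteq> 0" "\<And>s t. s > 0 \<Longrightarrow> t > 0 \<Longrightarrow> of_real s * u \<noteq> of_real t * v"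
  obtains \<kappa> where "\<kappa> > 0" "\<And>s t. s > 0 \<Longrightarrow> t \<ge> 0 \<Longrightarrow> norm (of_real s * u - of_real t * v) \<ge> s * \<kappa>"
proof -
  define a b where "a = u /\<^sub>R norm u" and "b = v /\<^sub>R norm v"
  define n where "n = a - b"
  have ab: "u = norm u *\<^sub>R a" "v = norm v *\<^sub>R b" "a \<bullet> a = 1" "b \<bullet> b = 1"
    using assms(1,2) by (auto simp: a_def b_def dot_square_norm)
  have "n \<noteq> 0" using assms(3)[of "inverse (norm u)" "inverse (norm v)"] assms(1,2)
    unfolding n_def a_def b_def by (simp add: scaleR_conv_of_real)
  have nn: "n \<bullet> n = 2 - 2 * (a \<bullet> b)" "n \<bullet> a = 1 - a \<bullet> b" "n \<bullet> b = a \<bullet> b - 1"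
    unfolding n_def using ab by (simp_all add: inner_diff_left inner_diff_right inner_commute)
  have u: "n \<bullet> u = norm u * (n \<bullet> n) / 2"
    by (subst ab(1)) (simp add: nn field_simps)
  have v: "n \<bullet> v = - norm v * (n \<bullet> n) / 2"
    by (subst ab(2)) (simp add: nn field_simps)
  have "s * (norm u * norm n / 2) \<le> norm (of_real s * u - of_real t * v)" if "s > 0" "t \<ge> 0" for s t
  proof -
    have "s * (norm u * norm n / 2) * norm n = s * (n \<bullet> u)"
      unfolding u by (simp add: dot_square_norm power2_eq_square)
    also have "\<dots> \<le> s * (n \<bullet> u) - t * (n \<bullet> v)" using that unfolding v by simp
    also have "\<dots> = n \<bullet> (s *\<^sub>R u - t *\<^sub>R v)" by (simp add: inner_diff_right)
    also have "\<dots> \<le> norm n * norm (s *\<^sub>R u - t *\<^sub>R v)" by (rule norm_cauchy_schwarz)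
    finally show ?thesis using \<open>n \<noteq> 0\<close> by (simp add: scaleR_conv_of_real mult.commute)
  qed
  moreover have "norm u * norm n / 2 > 0" using assms(1) \<open>n \<noteq> 0\<close> by simp
  ultimately show ?thesis using that by blast
qed

lemma wedge_cone:
  fixes m u :: complex
  assumes "0 < s0" "0 < \<kappa>" "\<kappa> \<le> norm u"
  shows "wedge m (\<Union>s\<in>{0<..<s0}. ball (m + of_real s * u) (s * \<kappa> / 2))" (is "wedge m ?D")
proof -
  have "u \<noteq> 0" using assms by auto
  have "convex ?D"
  proof (rule convexI)
    fix x y and p q :: real
    assume xy: "x \<in> ?D" "y \<in> ?D" and pq: "0 \<le> p" "0 \<le> q" "p + q = 1"
    then obtain s t where s: "0 < s" "s < s0" "norm (m + of_real s * u - x) < s * \<kappa> / 2"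
      and t: "0 < t" "t < s0" "norm (m + of_real t * u - y) < t * \<kappa> / 2"
      by (auto simp: dist_norm)
    let ?r = "p * s + q * t"
    have r: "0 < ?r" "?r < s0"
      using convex_bound_lt[of s s0 t p q] convex_bound_lt[of "-s" 0 "-t" p q] s t pq by auto
    have q: "q = 1 - p" using pq by simp
    have "m + of_real ?r * u - (p *\<^sub>R x + q *\<^sub>R y) =
      p *\<^sub>R (m + of_real s * u - x) + q *\<^sub>R (m + of_real t * u - y)"
      unfolding q by (simp add: scaleR_conv_of_real algebra_simps)
    then have "norm (m + of_real ?r * u - (p *\<^sub>R x + q *\<^sub>R y)) \<le>
      p * norm (m + of_real s * u - x) + q * norm (m + of_real t * u - y)"
      using norm_triangle_ineq[of "p *\<^sub>R (m + of_real s * u - x)" "q *\<^sub>R (m + of_real t * u - y)"] pq by simp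
    also have "\<dots> < ?r * \<kappa> / 2"
    proof (cases "p = 0")
      case True then show ?thesis using t pq by simp
    next
      case False
      then have "p * norm (m + of_real s * u - x) < p * (s * \<kappa> / 2)" using s pq by simp
      moreover have "q * norm (m + of_real t * u - y) \<le> q * (t * \<kappa> / 2)"
        using t pq by (intro mult_left_mono) auto
      ultimately show ?thesis by (simp add: field_simps)
    qed
    finally have "p *\<^sub>R x + q *\<^sub>R y \<in> ball (m + of_real ?r * u) (?r * \<kappa> / 2)"
      by (simp only: mem_ball dist_norm)
    then show "p *\<^sub>R x + q *\<^sub>R y \<in> ?D" using r by (intro UN_I[of ?r]) auto
  qed
  moreover have "m \<in> closure ?D" unfolding closure_approachable
  proof (intro allI impI)
    fix e :: real assume "e > 0"
    define s where "s = min (s0 / 2) (e / (2 * norm u))"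
    have s: "0 < s" "s < s0" "s \<le> e / (2 * norm u)" using \<open>e > 0\<close> assms \<open>u \<noteq> 0\<close> by (auto simp: s_def)
    have "s * norm u \<le> e / 2" using s(3) \<open>u \<noteq> 0\<close> by (simp add: field_simps)
    then have "dist (m + of_real s * u) m < e" using s(1) \<open>e > 0\<close> by (simp add: dist_norm norm_mult)
    moreover have "m + of_real s * u \<in> ?D" using s assms by force
    ultimately show "\<exists>y\<in>?D. dist y m < e" by blast
  qed
  moreover have "m \<notin> ?D"
  proof
    assume "m \<in> ?D"
    then obtain s where s: "0 < s" "norm (of_real s * u) < s * \<kappa> / 2" by (auto simp: dist_norm)
    then have "norm u < \<kappa> / 2" by (simp add: norm_mult)
    then show False using assms by linarith
  qed
  ultimately show ?thesis unfolding wedge_def by auto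
qed

lemma wedge_in_collar:
  assumes X: "X \<noteq> {}" and Y: "closed_segment m c \<subseteq> Y" "c \<noteq> m" and r: "r > 0" and P: "finite P"
    and XP: "X \<inter> ball m r \<subseteq> (\<Union>d\<in>P. closed_segment m d)"
    and sep: "\<And>d. d \<in> P \<Longrightarrow> closed_segment m c \<inter> closed_segment m d = {m}"
  obtains D where "wedge m D" "D \<subseteq> collar X Y"
proof -
  define u where "u = c - m"
  have u0: "u \<noteq> 0" using Y by (simp add: u_def)
  have "\<exists>\<kappa>>0. \<forall>s>0. \<forall>t\<ge>0. norm (of_real s * u - of_real t * (d - m)) \<ge> s * \<kappa>" if d: "d \<in> P" for d
  proof (cases "d = m")
    case True
    then show ?thesis using u0 by (intro exI[of _ "norm u"]) (auto simp: norm_mult)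
  next
    case False
    have "of_real s * u \<noteq> of_real t * (d - m)" if st: "s > 0" "t > 0" for s t
    proof
      assume eq: "of_real s * u = of_real t * (d - m)"
      define k where "k = inverse (max s t)"
      have k: "k > 0" "k * s \<le> 1" "k * t \<le> 1" using st unfolding k_def by (auto simp: field_simps)
      have "m + of_real (k * s) * u = m + of_real (k * t) * (d - m)" using eq by (simp add: mult.assoc)
      moreover have "m + of_real (k * s) * u \<in> closed_segment m c"
        unfolding in_segment u_def using k st by (intro exI[of _ "k * s"]) (auto simp: scaleR_conv_of_real algebra_simps)
      moreover have "m + of_real (k * t) * (d - m) \<in> closed_segment m d"
        unfolding in_segment using k st by (intro exI[of _ "k * t"]) (auto simp: scaleR_conv_of_real algebra_simps)
      ultimately have "m + of_real (k * s) * u = m" using sep[OF d] by (metis IntI singletonD)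
      then show False using k st u0 by simp
    qed
    then obtain \<kappa> where "\<kappa> > 0" "\<And>s t. s > 0 \<Longrightarrow> t \<ge> 0 \<Longrightarrow> norm (of_real s * u - of_real t * (d - m)) \<ge> s * \<kappa>"
      using ray_separation[OF u0, of "d - m"] False by (metis eq_iff_diff_eq_0)
    then show ?thesis by blast
  qed
  then obtain \<kappa>' where \<kappa>': "\<And>d. d \<in> P \<Longrightarrow> \<kappa>' d > 0"
    "\<And>d s t. d \<in> P \<Longrightarrow> s > 0 \<Longrightarrow> t \<ge> 0 \<Longrightarrow> norm (of_real s * u - of_real t * (d - m)) \<ge> s * \<kappa>' d"
    by metis
  define \<kappa> where "\<kappa> = Min (insert (norm u) (\<kappa>' ` P))"
  have \<kappa>: "\<kappa> > 0" "\<kappa> \<le> norm u" "\<And>d. d \<in> P \<Longrightarrow> \<kappa> \<le> \<kappa>' d"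
    unfolding \<kappa>_def using P u0 \<kappa>'(1) by (auto simp: Min_le_iff)
  define s0 where "s0 = min 1 (r / (2 * norm u))"
  have s0: "s0 > 0" "s0 \<le> 1" "s0 \<le> r / (2 * norm u)" using r u0 by (auto simp: s0_def)
  let ?D = "\<Union>s\<in>{0<..<s0}. ball (m + of_real s * u) (s * \<kappa> / 2)"
  have inf: "infdist (m + of_real s * u) X \<ge> s * \<kappa>" if s: "0 < s" "s < s0" for s
    unfolding infdist_notempty[OF X]
  proof (rule cINF_greatest)
    fix x assume x: "x \<in> X"
    have su: "s * norm u \<le> r / 2"
    proof -
      have "s * norm u \<le> r / (2 * norm u) * norm u" using s s0 by (intro mult_right_mono) auto
      then show ?thesis using u0 by simp
    qed
    show "s * \<kappa> \<le> dist (m + of_real s * u) x"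
    proof (cases "x \<in> ball m r")
      case True
      then obtain d where d: "d \<in> P" "x \<in> closed_segment m d" using XP x by auto
      then obtain t where t: "0 \<le> t" "x = m + of_real t * (d - m)"
        unfolding in_segment by (auto simp: scaleR_conv_of_real algebra_simps)
      have "s * \<kappa> \<le> s * \<kappa>' d" using \<kappa>(3)[OF d(1)] s by simp
      also have "\<dots> \<le> dist (m + of_real s * u) x" using \<kappa>'(2)[OF d(1) s(1) t(1)] t by (simp add: dist_norm)
      finally show ?thesis .
    next
      case False
      have "s * \<kappa> \<le> s * norm u" using s \<kappa> by simp
      moreover have "r \<le> dist m x" using False by simp
      moreover have "dist m x \<le> dist m (m + of_real s * u) + dist (m + of_real s * u) x" by (rule dist_triangle)
      moreover have "dist m (m + of_real s * u) = s * norm u" using s by (simp add: dist_norm norm_mult)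
      ultimately show ?thesis using su by linarith
    qed
  qed (use X in auto)
  have "?D \<subseteq> collar X Y"
  proof (rule UN_least)
    fix s assume "s \<in> {0<..<s0}"
    then have s: "0 < s" "s < s0" by auto
    have "s * \<kappa> > 0" using s \<kappa> by simp
    then have "m + of_real s * u \<notin> X" using inf[OF s] by (metis infdist_zero not_less)
    moreover have "m + of_real s * u \<in> closed_segment m c"
      unfolding in_segment u_def using s s0 by (intro exI[of _ s]) (auto simp: scaleR_conv_of_real algebra_simps)
    ultimately have "ball (m + of_real s * u) (infdist (m + of_real s * u) X / 2) \<subseteq> collar X Y"
      unfolding collar_def using Y by blast
    moreover have "ball (m + of_real s * u) (s * \<kappa> / 2) \<subseteq> ball (m + of_real s * u) (infdist (m + of_real s * u) X / 2)"
      using inf[OF s] by (intro subset_ball) simp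
    ultimately show "ball (m + of_real s * u) (s * \<kappa> / 2) \<subseteq> collar X Y" by blast
  qed
  then show ?thesis using that wedge_cone[OF s0(1) \<kappa>(1,2)] by blast
qed

section \<open>Half-squares of plane bipartite drawings\<close>

text \<open>
  Every edge \<open>e = (a, b)\<close> is cut at the parameter \<open>\<tau> e\<close>. The part before the cut stays in a small ball about \<open>p a\<close>
  and is redrawn; the part after the cut is kept. The set \<open>\<Gamma>\<close> stands for the outer face, and the vertices in \<open>Q\<close>
  receive an additional curve to it. Choosing \<open>\<delta>\<close> before \<open>\<Gamma>\<close> lets \<open>\<Gamma>\<close> come so close to \<open>p a\<close> that a straight
  segment from it first meets the drawing on an initial piece of an edge at \<open>a\<close>.
\<close>

locale cut_drawing =
  fixes A B :: "'a set" and E :: "('a \<times> 'a) set" and p :: "'a \<Rightarrow> complex"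
    and \<gamma> :: "'a \<times> 'a \<Rightarrow> real \<Rightarrow> complex" and \<tau> :: "'a \<times> 'a \<Rightarrow> real"
    and r \<delta> :: real and \<Gamma> :: "complex set" and Q :: "'a set"
  assumes fin: "finite A" "finite B" and AB: "A \<inter> B = {}" and E: "E \<subseteq> A \<times> B"
    and inj_p: "inj_on p (A \<union> B)"
    and arc: "e \<in> E \<Longrightarrow> arc (\<gamma> e)"
    and start: "e \<in> E \<Longrightarrow> \<gamma> e 0 = p (fst e)" and finish: "e \<in> E \<Longrightarrow> \<gamma> e 1 = p (snd e)"
    and vertex: "e \<in> E \<Longrightarrow> v \<in> A \<union> B \<Longrightarrow> p v \<in> path_image (\<gamma> e) \<Longrightarrow> v \<in> {fst e, snd e}"
    and cross: "e \<in> E \<Longrightarrow> e' \<in> E \<Longrightarrow> e \<noteq> e' \<Longrightarrow>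
      path_image (\<gamma> e) \<inter> path_image (\<gamma> e') \<subseteq> p ` ({fst e, snd e} \<inter> {fst e', snd e'})"
    and deg: "b \<in> B \<Longrightarrow> card {a. (a, b) \<in> E} \<le> 3"
    and \<tau>: "e \<in> E \<Longrightarrow> 0 < \<tau> e \<and> \<tau> e < 1"
    and near: "e \<in> E \<Longrightarrow> \<gamma> e ` {0..\<tau> e} \<subseteq> ball (p (fst e)) r"
    and r: "r > 0" and balls: "a \<in> A \<Longrightarrow> a' \<in> A \<Longrightarrow> a \<noteq> a' \<Longrightarrow> ball (p a) r \<inter> ball (p a') r = {}"
    and \<delta>: "\<delta> \<le> r" "a \<in> A \<Longrightarrow> ball (p a) \<delta> \<inter> (\<Union>e\<in>E. \<gamma> e ` {\<tau> e..1}) = {}"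
      "a \<in> A \<Longrightarrow> ball (p a) \<delta> \<inter> p ` (A \<union> B) \<subseteq> {p a}"
    and \<Gamma>: "closed \<Gamma>" "\<Gamma> \<noteq> {}" "\<Gamma> \<inter> (p ` (A \<union> B) \<union> (\<Union>e\<in>E. path_image (\<gamma> e))) = {}"
    and Q: "Q \<subseteq> A" "a \<in> Q \<Longrightarrow> \<Gamma> \<inter> ball (p a) \<delta> \<noteq> {}"
begin

definition tail :: "'a \<times> 'a \<Rightarrow> complex set" where "tail e = \<gamma> e ` {\<tau> e..1}"
definition port :: "'a \<times> 'a \<Rightarrow> complex" where "port e = \<gamma> e (\<tau> e)"
definition tails :: "complex set" where "tails = (\<Union>e\<in>E. tail e)"
definition region :: "'a \<Rightarrow> complex set" where
  "region a = connected_component_set (ball (p a) r - (tails \<union> \<Gamma>)) (p a)"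

lemma finite_E: "finite E" using E fin by (meson finite_SigmaI finite_subset)

lemma E_mem: "e \<in> E \<Longrightarrow> fst e \<in> A \<and> snd e \<in> B" using E by auto

lemma \<gamma>_inj: "e \<in> E \<Longrightarrow> s \<in> {0..1} \<Longrightarrow> t \<in> {0..1} \<Longrightarrow> \<gamma> e s = \<gamma> e t \<Longrightarrow> s = t"
  using arc inj_onD unfolding arc_def by metis

lemma image_subset: "s \<subseteq> {0..1} \<Longrightarrow> \<gamma> e ` s \<subseteq> path_image (\<gamma> e)"
  unfolding path_image_def by blast

lemma tail_joins: "e \<in> E \<Longrightarrow> joins (tail e) (port e) (p (snd e))"
  using joins_subpath[OF arc, of e "\<tau> e" 1] \<tau>[of e] finish[of e] unfolding tail_def port_def by auto

lemma port_tail: "e \<in> E \<Longrightarrow> port e \<in> tail e \<and> p (snd e) \<in> tail e"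
  using joins_ends[OF tail_joins] by blast

lemma tail_subset: "e \<in> E \<Longrightarrow> tail e \<subseteq> path_image (\<gamma> e)"
  unfolding tail_def using \<tau>[of e] by (intro image_subset) auto

lemma start_tail:
  assumes e: "e \<in> E" shows "p (fst e) \<notin> tail e"
proof
  assume "p (fst e) \<in> tail e"
  then obtain t where t: "t \<in> {\<tau> e..1}" "\<gamma> e 0 = \<gamma> e t" unfolding tail_def start[OF e, symmetric] by blast
  then show False using \<gamma>_inj[OF e, of 0 t] \<tau>[OF e] by auto
qed

lemma vertex_neq: "a \<in> A \<Longrightarrow> b \<in> B \<Longrightarrow> p a \<noteq> p b"
  using inj_onD[OF inj_p, of a b] AB by auto

lemma pA_tail: "e \<in> E \<Longrightarrow> a \<in> A \<Longrightarrow> p a \<notin> tail e"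
  using vertex[of e a] start_tail[of e] tail_subset[of e] AB E_mem[of e] by blast

lemma tails_disjoint:
  assumes "e \<in> E" "e' \<in> E" "snd e \<noteq> snd e'" shows "tail e \<inter> tail e' = {}"
proof -
  have "x \<notin> tail e'" if "x \<in> tail e" for x
  proof
    assume x': "x \<in> tail e'"
    have "x \<in> p ` ({fst e, snd e} \<inter> {fst e', snd e'})"
      using cross[of e e'] that x' tail_subset assms by blast
    then obtain v where "x = p v" "v \<in> {fst e, snd e} \<inter> {fst e', snd e'}" by blast
    then have "x = p (fst e)" using E_mem[OF assms(1)] E_mem[OF assms(2)] assms(3) AB by auto
    then show False using start_tail[OF assms(1)] that by simp
  qed
  then show ?thesis by blast
qed

lemma port_inj:
  assumes "e \<in> E" "e' \<in> E" "port e = port e'" shows "e = e'"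
proof (rule ccontr)
  assume "e \<noteq> e'"
  then have "port e \<in> p ` ({fst e, snd e} \<inter> {fst e', snd e'})"
    using cross[OF assms(1,2)] port_tail[OF assms(1)] port_tail[OF assms(2)] tail_subset[OF assms(1)]
      tail_subset[OF assms(2)] assms(3) by auto
  then have "port e \<in> {p (fst e), p (snd e)}" by blast
  then show False using \<gamma>_inj[OF assms(1), of "\<tau> e" 0] \<gamma>_inj[OF assms(1), of "\<tau> e" 1] \<tau>[OF assms(1)]
      start[OF assms(1)] finish[OF assms(1)] unfolding port_def by auto
qed

lemma closed_tails: "closed tails"
  unfolding tails_def using finite_E tail_joins joins_compact compact_imp_closed by (intro closed_UN) blast+

lemma pA_tails: "a \<in> A \<Longrightarrow> p a \<notin> tails" unfolding tails_def using pA_tail by blast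

lemma tails_\<Gamma>: "tails \<inter> \<Gamma> = {}" unfolding tails_def using tail_subset \<Gamma>(3) by blast

lemma region:
  assumes "a \<in> A"
  shows "open (region a)" "connected (region a)" "p a \<in> region a" "region a \<subseteq> ball (p a) r" "region a \<inter> (tails \<union> \<Gamma>) = {}"
proof -
  have o: "open (ball (p a) r - (tails \<union> \<Gamma>))" using closed_tails \<Gamma>(1) by (intro open_Diff) auto
  have m: "p a \<in> ball (p a) r - (tails \<union> \<Gamma>)" using r pA_tails[OF assms] \<Gamma>(3) assms by auto
  show "open (region a)" "connected (region a)" unfolding region_def using o by (auto intro: open_connected_component)
  show "p a \<in> region a" unfolding region_def using m by simp
  show "region a \<subseteq> ball (p a) r" "region a \<inter> (tails \<union> \<Gamma>) = {}"
    unfolding region_def using connected_component_subset[of "ball (p a) r - (tails \<union> \<Gamma>)" "p a"] by blast+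
qed

lemma in_region:
  assumes "a \<in> A" "connected S" "x \<in> S" "x \<in> region a" "S \<subseteq> ball (p a) r" "S \<inter> (tails \<union> \<Gamma>) = {}"
  shows "S \<subseteq> region a"
proof -
  have "S \<subseteq> connected_component_set (ball (p a) r - (tails \<union> \<Gamma>)) x"
    using assms by (intro connected_component_maximal) auto
  also have "\<dots> = region a" using assms(4) unfolding region_def by (metis connected_component_eq)
  finally show ?thesis .
qed

lemma regions_disjoint: "a \<in> A \<Longrightarrow> a' \<in> A \<Longrightarrow> a \<noteq> a' \<Longrightarrow> region a \<inter> region a' = {}"
  using region(4) balls by blast

lemma initial_region:
  assumes e: "e \<in> E" shows "\<gamma> e ` {0..<\<tau> e} \<subseteq> region (fst e)"
proof (rule in_region)
  show a: "fst e \<in> A" using E_mem e by blast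
  have "continuous_on {0..1} (\<gamma> e)" using arc[OF e] by (auto simp: arc_def path_def)
  then show "connected (\<gamma> e ` {0..<\<tau> e})"
    using \<tau>[OF e] by (intro connected_continuous_image) (auto intro: continuous_on_subset)
  show "p (fst e) \<in> \<gamma> e ` {0..<\<tau> e}" using start[OF e] \<tau>[OF e] by force
  show "p (fst e) \<in> region (fst e)" using region(3)[OF a] .
  show "\<gamma> e ` {0..<\<tau> e} \<subseteq> ball (p (fst e)) r" using near[OF e] by force
  have sub: "\<gamma> e ` {0..<\<tau> e} \<subseteq> path_image (\<gamma> e)" using \<tau>[OF e] by (intro image_subset) auto
  have "\<gamma> e ` {0..<\<tau> e} \<inter> tail e' = {}" if e': "e' \<in> E" for e'
  proof (cases "e' = e")
    case True
    have "\<gamma> e s \<noteq> \<gamma> e t" if "s \<in> {0..<\<tau> e}" "t \<in> {\<tau> e..1}" for s t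
      using \<gamma>_inj[OF e, of s t] \<tau>[OF e] that by auto
    then show ?thesis unfolding tail_def True by blast
  next
    case False
    have "x \<notin> tail e'" if x: "x \<in> \<gamma> e ` {0..<\<tau> e}" for x
    proof
      assume x': "x \<in> tail e'"
      have "x \<in> p ` ({fst e, snd e} \<inter> {fst e', snd e'})"
        using cross[OF e e'] x' tail_subset[OF e'] sub x False by blast
      then obtain v where v: "x = p v" "v \<in> {fst e, snd e}" "v \<in> {fst e', snd e'}" by blast
      have "x \<noteq> p (snd e)" using x \<gamma>_inj[OF e, of _ 1] finish[OF e] \<tau>[OF e] by force
      then have "v = fst e" using v by auto
      then show False using pA_tail[OF e' a] x' v by simp
    qed
    then show ?thesis by blast
  qed
  moreover have "\<gamma> e ` {0..<\<tau> e} \<inter> \<Gamma> = {}" using sub \<Gamma>(3) e by blast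
  ultimately show "\<gamma> e ` {0..<\<tau> e} \<inter> (tails \<union> \<Gamma>) = {}" unfolding tails_def by blast
qed

lemma port_access:
  assumes e: "e \<in> E" shows "\<exists>H d. joins H (port e) d \<and> H - {port e} \<subseteq> region (fst e) - {p (fst e)}"
proof -
  have t: "0 < \<tau> e" "\<tau> e < 1" using \<tau>[OF e] by auto
  have "joins (\<gamma> e ` {\<tau> e / 2..\<tau> e}) (port e) (\<gamma> e (\<tau> e / 2))"
    unfolding port_def using t by (intro joins_sym[OF joins_subpath] arc e) auto
  moreover have "\<gamma> e ` {\<tau> e / 2..\<tau> e} - {port e} \<subseteq> \<gamma> e ` {0..<\<tau> e}"
    using t unfolding port_def by (auto simp: less_le intro!: imageI)
  then have "\<gamma> e ` {\<tau> e / 2..\<tau> e} - {port e} \<subseteq> region (fst e)" using initial_region[OF e] by blast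
  moreover have "\<gamma> e 0 \<noteq> \<gamma> e t" if "t \<in> {\<tau> e / 2..\<tau> e}" for t
    using \<gamma>_inj[OF e, of 0 t] t that by auto
  then have "p (fst e) \<notin> \<gamma> e ` {\<tau> e / 2..\<tau> e}" unfolding start[OF e, symmetric] by blast
  ultimately show ?thesis by blast
qed

lemma \<Gamma>_access:
  assumes a: "a \<in> Q" shows "\<exists>y. y \<in> \<Gamma> \<and> (\<exists>H d. joins H y d \<and> H - {y} \<subseteq> region a - {p a})"
proof -
  have aA: "a \<in> A" using a Q by blast
  obtain z where z: "z \<in> \<Gamma>" "z \<in> ball (p a) \<delta>" using Q(2)[OF a] by blast
  define S where "S = p ` (A \<union> B) \<union> (\<Union>e\<in>E. path_image (\<gamma> e))"
  have "compact (\<Union>e\<in>E. path_image (\<gamma> e))" using finite_E arc compact_arc_image by (intro compact_UN) blast+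
  moreover have "compact (p ` (A \<union> B))" using fin by (intro finite_imp_compact) auto
  ultimately have S: "compact S" unfolding S_def by (rule compact_Un[rotated])
  have paS: "p a \<in> S" unfolding S_def using aA by blast
  have \<Gamma>S: "\<Gamma> \<inter> S = {}" using \<Gamma>(3) S_def by simp
  let ?s = "closed_segment z (p a)"
  have za: "z \<noteq> p a" using z(1) paS \<Gamma>S by blast
  have cs: "compact (\<Gamma> \<inter> ?s)" using \<Gamma>(1) by (simp add: closed_Int_compact)
  have d: "(\<Gamma> \<inter> ?s) \<inter> S = {}" using \<Gamma>S by blast
  obtain M y s where M: "joins M y s" "M \<subseteq> ?s" "M \<inter> (\<Gamma> \<inter> ?s) = {y}" "M \<inter> S = {s}"
    by (rule joins_between[OF joins_segment[OF za] cs S d]) (use z paS in auto)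
  have seg: "?s \<subseteq> ball (p a) \<delta>" using z(2) le_less_trans[OF zero_le_dist[of "p a" z]]
    by (intro closed_segment_subset) auto
  have y: "y \<in> \<Gamma>" using M by blast
  have s: "s \<in> M" "s \<in> S" "s \<noteq> y" using M \<Gamma>S by blast+
  have "s \<in> region a"
  proof (cases "s \<in> p ` (A \<union> B)")
    case True
    then have "s = p a" using \<delta>(3)[OF aA] seg M s by blast
    then show ?thesis using region(3)[OF aA] by simp
  next
    case False
    then obtain e where e: "e \<in> E" "s \<in> path_image (\<gamma> e)" using s unfolding S_def by blast
    have "s \<notin> tail e" using \<delta>(2)[OF aA] seg M(2) s e(1) unfolding tail_def by blast
    then have "s \<in> \<gamma> e ` {0..<\<tau> e}" using e(2) unfolding tail_def path_image_def by force
    then have sR: "s \<in> region (fst e)" using initial_region[OF e(1)] by blast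
    have "s \<in> ball (p a) r" using seg M(2) s \<delta>(1) by auto
    then have "fst e = a" using sR region(4)[of "fst e"] E_mem[OF e(1)] balls[of "fst e" a] aA by blast
    then show ?thesis using sR by simp
  qed
  then have "M - {y} \<subseteq> region a"
  proof (rule in_region[OF aA joins_connected(1)[OF M(1)], rotated])
    show "s \<in> M - {y}" using s by auto
    show "M - {y} \<subseteq> ball (p a) r" using M(2) seg \<delta>(1) subset_ball[OF \<delta>(1)] by blast
    have "M \<inter> tails = {}" using M(2) seg \<delta>(2)[OF aA] unfolding tails_def tail_def by blast
    then show "(M - {y}) \<inter> (tails \<union> \<Gamma>) = {}" using M(2,3) by blast
  qed
  moreover have "dist y (p a) > 0" using y paS \<Gamma>S by auto
  then obtain H d where H: "joins H y d" "H \<subseteq> M" "H \<subseteq> ball y (dist y (p a))"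
    using joins_initial[OF M(1)] by blast
  have "p a \<notin> H" using H(3) by auto
  ultimately have "joins H y d \<and> H - {y} \<subseteq> region a - {p a}" using H by blast
  then show ?thesis using y by blast
qed

definition outlet :: "'a \<Rightarrow> complex" where
  "outlet a = (SOME y. y \<in> \<Gamma> \<and> (\<exists>H d. joins H y d \<and> H - {y} \<subseteq> region a - {p a}))"

definition ports :: "'a \<Rightarrow> complex set" where
  "ports a = port ` {e \<in> E. fst e = a} \<union> (if a \<in> Q then {outlet a} else {})"

lemma outlet: "a \<in> Q \<Longrightarrow> outlet a \<in> \<Gamma> \<and> (\<exists>H d. joins H (outlet a) d \<and> H - {outlet a} \<subseteq> region a - {p a})"
  unfolding outlet_def by (rule someI_ex[OF \<Gamma>_access])

lemma ports_subset: "x \<in> ports a \<Longrightarrow> x \<in> tails \<union> \<Gamma>"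
  unfolding ports_def tails_def using port_tail outlet by (auto split: if_splits)

lemma ex_legs:
  assumes "a \<in> A"
  shows "\<exists>L. (\<forall>x\<in>ports a. joins (L x) (p a) x \<and> L x - {x} \<subseteq> region a \<and> straight (p a) (L x)) \<and>
    (\<forall>x\<in>ports a. \<forall>y\<in>ports a. x \<noteq> y \<longrightarrow> L x \<inter> L y = {p a})"
proof -
  have f: "finite (ports a)" unfolding ports_def using finite_E by auto
  have *: "x \<notin> region a \<and> (\<exists>H d. joins H x d \<and> H - {x} \<subseteq> region a - {p a})" if x: "x \<in> ports a" for x
  proof
    show "x \<notin> region a" using ports_subset[OF x] region(5)[OF assms] by blast
    show "\<exists>H d. joins H x d \<and> H - {x} \<subseteq> region a - {p a}"
      using x port_access outlet[of a] unfolding ports_def by (auto split: if_splits)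
  qed
  show ?thesis
  proof (rule spider[OF region(1-3)[OF assms] f *])
    fix L assume L: "\<And>x. x \<in> ports a \<Longrightarrow> joins (L x) (p a) x \<and> L x - {x} \<subseteq> region a \<and> straight (p a) (L x)"
      "\<And>x y. x \<in> ports a \<Longrightarrow> y \<in> ports a \<Longrightarrow> x \<noteq> y \<Longrightarrow> L x \<inter> L y = {p a}"
    show ?thesis by (rule exI[of _ L]) (use L in simp)
  qed
qed

definition leg :: "'a \<Rightarrow> complex \<Rightarrow> complex set" where
  "leg a = (SOME L. (\<forall>x\<in>ports a. joins (L x) (p a) x \<and> L x - {x} \<subseteq> region a \<and> straight (p a) (L x)) \<and>
    (\<forall>x\<in>ports a. \<forall>y\<in>ports a. x \<noteq> y \<longrightarrow> L x \<inter> L y = {p a}))"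

lemma leg:
  assumes "a \<in> A" "x \<in> ports a"
  shows "joins (leg a x) (p a) x" "leg a x - {x} \<subseteq> region a" "straight (p a) (leg a x)"
    "y \<in> ports a \<Longrightarrow> x \<noteq> y \<Longrightarrow> leg a x \<inter> leg a y = {p a}"
proof -
  note * = someI_ex[OF ex_legs[OF assms(1)], folded leg_def]
  show "joins (leg a x) (p a) x" "leg a x - {x} \<subseteq> region a" "straight (p a) (leg a x)"
    using * assms(2) by simp_all
  show "leg a x \<inter> leg a y = {p a}" if "y \<in> ports a" "x \<noteq> y"
    using *[THEN conjunct2, rule_format, OF assms(2) that] .
qed

lemma port_in_ports: "e \<in> E \<Longrightarrow> port e \<in> ports (fst e)" unfolding ports_def by auto
lemma outlet_in_ports: "a \<in> Q \<Longrightarrow> outlet a \<in> ports a" unfolding ports_def by auto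

lemma legs_inter:
  assumes a: "a \<in> A" "a' \<in> A" and x: "x \<in> ports a" "x' \<in> ports a'" and ne: "x \<noteq> x'"
  shows "leg a x \<inter> leg a' x' \<subseteq> p ` A"
proof (cases "a = a'")
  case True
  then show ?thesis using leg(4)[OF a(1) x(1), of x'] x ne a by auto
next
  case False
  have "x \<notin> region a'" "x' \<notin> region a" using ports_subset x region(5) a by blast+
  then show ?thesis using leg(2)[OF a(1) x(1)] leg(2)[OF a(2) x(2)] regions_disjoint[OF a False] ne by blast
qed

lemma leg_tail:
  assumes a: "a \<in> A" and x: "x \<in> ports a" "x \<notin> tail e" and e: "e \<in> E"
  shows "leg a x \<inter> tail e = {}"
  using leg(2)[OF a x(1)] region(5)[OF a] e x unfolding tails_def by blast

lemma leg_\<Gamma>: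
  assumes "e \<in> E" shows "leg (fst e) (port e) \<inter> \<Gamma> = {}"
  using leg(2)[of "fst e" "port e"] port_in_ports[OF assms] E_mem[OF assms] region(5)[of "fst e"] tails_\<Gamma> port_tail[OF assms]
    assms unfolding tails_def by blast

definition piece :: "'a \<times> 'a \<Rightarrow> complex set" where
  "piece e = tail e \<union> leg (fst e) (port e)"
definition star :: "'a \<Rightarrow> complex set" where
  "star b = (\<Union>e\<in>{e\<in>E. snd e = b}. piece e)"
definition out_legs :: "complex set" where
  "out_legs = (\<Union>a\<in>Q. leg a (outlet a))"
definition obstacle :: "'a \<Rightarrow> complex set" where
  "obstacle b = p ` A \<union> \<Gamma> \<union> out_legs \<union> (\<Union>b'\<in>B - {b}. star b')"
definition nbhd :: "'a \<Rightarrow> complex set" where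
  "nbhd b = collar (obstacle b) (star b)"

lemma pieces_inter:
  assumes "e \<in> E" "e' \<in> E" "snd e \<noteq> snd e'" shows "piece e \<inter> piece e' \<subseteq> p ` A"
proof -
  have ne: "e \<noteq> e'" using assms by auto
  have A: "fst e \<in> A" "fst e' \<in> A" using E_mem assms by auto
  have 1: "tail e \<inter> tail e' = {}" using tails_disjoint assms by blast
  have n: "port e \<noteq> port e'" using port_inj assms ne by blast
  have 2: "leg (fst e) (port e) \<inter> tail e' = {}" "leg (fst e') (port e') \<inter> tail e = {}"
    using leg_tail A port_in_ports assms 1 port_tail by blast+
  have 3: "leg (fst e) (port e) \<inter> leg (fst e') (port e') \<subseteq> p ` A"
    using legs_inter A port_in_ports assms n by blast
  show ?thesis unfolding piece_def using 1 2 3 by blast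
qed

lemma out_piece:
  assumes "e \<in> E" "a \<in> Q" shows "leg a (outlet a) \<inter> piece e \<subseteq> p ` A"
proof -
  have a: "a \<in> A" "outlet a \<in> ports a" "outlet a \<in> \<Gamma>" using assms Q outlet outlet_in_ports by auto
  have n: "outlet a \<notin> tail e" using a(3) tails_\<Gamma> assms unfolding tails_def by blast
  have "leg a (outlet a) \<inter> leg (fst e) (port e) \<subseteq> p ` A"
    using legs_inter[OF a(1) _ a(2) port_in_ports[OF assms(1)]] E_mem[OF assms(1)] n port_tail[OF assms(1)] by metis
  then show ?thesis unfolding piece_def using leg_tail[OF a(1,2) n assms(1)] by blast
qed

lemma finite_ports: "finite (ports a)" unfolding ports_def using finite_E by auto

lemma closed_leg: "a \<in> A \<Longrightarrow> x \<in> ports a \<Longrightarrow> closed (leg a x)"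
  using leg(1) joins_compact compact_imp_closed by blast

lemma closed_piece: "e \<in> E \<Longrightarrow> closed (piece e)"
  unfolding piece_def using closed_leg port_in_ports E_mem tail_joins joins_compact compact_imp_closed
  by (intro closed_Un) blast+

lemma closed_obstacle: "closed (obstacle b)"
proof -
  have "closed (star b')" for b' unfolding star_def using finite_E closed_piece by (intro closed_UN) auto
  moreover have "closed out_legs" unfolding out_legs_def
    using closed_leg Q outlet_in_ports finite_subset[OF Q(1) fin(1)] by (intro closed_UN) blast+
  moreover have "closed (\<Union>b'\<in>B - {b}. star b')" using fin calculation(1) by (intro closed_UN) auto
  moreover have "closed (p ` A)" using fin by (intro finite_imp_closed) auto
  ultimately show ?thesis unfolding obstacle_def using \<Gamma>(1) by (intro closed_Un)
qed

lemma obstacle_nonempty: "obstacle b \<noteq> {}" using \<Gamma>(2) unfolding obstacle_def by blast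

lemma nbhds_disjoint: "b \<in> B \<Longrightarrow> b' \<in> B \<Longrightarrow> b \<noteq> b' \<Longrightarrow> nbhd b \<inter> nbhd b' = {}"
  unfolding nbhd_def by (rule collars_disjoint) (auto simp: obstacle_def)

lemma star_obstacle: "star b - obstacle b = star b - p ` A"
proof -
  have "star b \<inter> star b' \<subseteq> p ` A" if "b' \<in> B - {b}" for b'
    unfolding star_def using pieces_inter that by blast
  then have "star b \<inter> (\<Union>b'\<in>B - {b}. star b') \<subseteq> p ` A" unfolding Int_UN_distrib by (rule UN_least)
  moreover have "star b \<inter> out_legs \<subseteq> p ` A" unfolding star_def out_legs_def using out_piece by blast
  moreover have "piece e \<inter> \<Gamma> = {}" if "e \<in> E" for e
    unfolding piece_def using leg_\<Gamma>[OF that] tails_\<Gamma> that unfolding tails_def by blast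
  then have "star b \<inter> \<Gamma> = {}" unfolding star_def by blast
  ultimately have "star b \<inter> obstacle b \<subseteq> p ` A" unfolding obstacle_def Int_Un_distrib by (intro Un_least) simp_all
  moreover have "p ` A \<subseteq> obstacle b" unfolding obstacle_def by blast
  ultimately show ?thesis by auto
qed

lemma leg_pA:
  assumes "a \<in> A" "x \<in> ports a" shows "leg a x \<inter> p ` A = {p a}"
proof -
  have "p a' \<notin> leg a x" if a': "a' \<in> A" "a' \<noteq> a" for a'
  proof
    assume "p a' \<in> leg a x"
    moreover have "p a' \<noteq> x" using ports_subset[OF assms(2)] region(3,5)[OF a'(1)] by blast
    ultimately have "p a' \<in> region a" using leg(2)[OF assms] by blast
    then show False using regions_disjoint[OF a'(1) assms(1) a'(2)] region(3)[OF a'(1)] by blast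
  qed
  then show ?thesis using joins_ends[OF leg(1)[OF assms]] assms(1) by blast
qed

lemma connected_star: "connected (star b - obstacle b)"
proof -
  have eq: "piece e - p ` A = tail e \<union> (leg (fst e) (port e) - {p (fst e)})" if "e \<in> E" for e
    unfolding piece_def using pA_tail[OF that] leg_pA[OF _ port_in_ports[OF that]] E_mem[OF that] by blast
  have "connected (piece e - p ` A)" if e: "e \<in> E" for e
    unfolding eq[OF e]
  proof (rule connected_Un)
    show "connected (tail e)" using joins_connected(3)[OF tail_joins[OF e]] .
    have *: "joins (leg (fst e) (port e)) (p (fst e)) (port e)" using leg(1) port_in_ports E_mem e by blast
    show "connected (leg (fst e) (port e) - {p (fst e)})" using joins_connected(1)[OF *] .
    show "tail e \<inter> (leg (fst e) (port e) - {p (fst e)}) \<noteq> {}"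
      using port_tail[OF e] joins_ends[OF *] by (metis DiffI IntI empty_iff singletonD)
  qed
  moreover have "p b \<in> piece e - p ` A" if "e \<in> E" "snd e = b" for e
  proof -
    have "p b \<noteq> p a" if "a \<in> A" for a using vertex_neq[OF that, of b] E_mem \<open>e \<in> E\<close> \<open>snd e = b\<close> by metis
    then show ?thesis using port_tail[OF that(1)] that(2) unfolding piece_def by auto
  qed
  ultimately have "connected (\<Union>e\<in>{e\<in>E. snd e = b}. piece e - p ` A)"
    by (intro connected_Union) blast+
  moreover have "(\<Union>e\<in>{e\<in>E. snd e = b}. piece e - p ` A) = star b - obstacle b"
    unfolding star_obstacle unfolding star_def by blast
  ultimately show ?thesis by simp
qed

lemma nbhd_props: "open (nbhd b)" "connected (nbhd b)" "nbhd b \<inter> obstacle b = {}"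
  unfolding nbhd_def using open_collar connected_collar[OF closed_obstacle obstacle_nonempty connected_star] collar_disjoint by blast+

lemma wedge_nbhd:
  assumes e: "e \<in> E" shows "\<exists>D. wedge (p (fst e)) D \<and> D \<subseteq> nbhd (snd e)"
proof -
  define a where "a = fst e"
  define b where "b = snd e"
  have a: "a \<in> A" and pT: "port e \<in> ports a" using E_mem port_in_ports e by (auto simp: a_def)
  define Z where "Z = p ` (A - {a}) \<union> \<Gamma> \<union> tails \<union> (\<Union>a'\<in>A - {a}. \<Union>x\<in>ports a'. leg a' x)"
  have "closed (\<Union>x\<in>ports a'. leg a' x)" if "a' \<in> A" for a'
    using closed_leg[OF that] finite_ports by (intro closed_UN) auto
  then have "closed (\<Union>a'\<in>A - {a}. \<Union>x\<in>ports a'. leg a' x)" using fin by (intro closed_UN) auto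
  moreover have "closed (p ` (A - {a}))" using fin by (intro finite_imp_closed) auto
  ultimately have "closed Z" unfolding Z_def using \<Gamma>(1) closed_tails by (intro closed_Un)
  moreover have "p a \<notin> Z"
  proof -
    have "p a \<notin> p ` (A - {a})" using inj_onD[OF inj_p, of a] a by blast
    moreover have "p a \<notin> \<Gamma>" "p a \<notin> tails" using region(3,5)[OF a] by blast+
    moreover have "p a \<notin> leg a' x" if "a' \<in> A - {a}" "x \<in> ports a'" for a' x
      using leg_pA[of a' x] that a inj_onD[OF inj_p, of a a'] by blast
    ultimately show ?thesis unfolding Z_def by blast
  qed
  ultimately obtain r0 where r0: "r0 > 0" "ball (p a) r0 \<inter> Z = {}"
    by (metis ComplI open_Compl open_contains_ball disjoint_eq_subset_Compl)
  obtain c \<rho> where c: "\<And>x. x \<in> ports a \<Longrightarrow> c x \<noteq> p a \<and> \<rho> x > 0 \<and> closed_segment (p a) (c x) \<subseteq> leg a x \<and>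
      leg a x \<inter> ball (p a) (\<rho> x) \<subseteq> closed_segment (p a) (c x)"
    using leg(3)[OF a] unfolding straight_def by metis
  define r1 where "r1 = Min (insert r0 (\<rho> ` ports a))"
  have r1: "r1 > 0" "r1 \<le> r0" "\<And>x. x \<in> ports a \<Longrightarrow> r1 \<le> \<rho> x"
    unfolding r1_def using finite_ports r0 c by (auto simp: Min_le_iff)
  have XZ: "obstacle b \<subseteq> {p a} \<union> Z \<union> (\<Union>x\<in>ports a - {port e}. leg a x)"
  proof -
    have un: "P \<union> G \<union> O' \<union> S \<subseteq> M \<union> Z \<union> Y" if "P \<subseteq> M \<union> Z" "G \<subseteq> Z" "O' \<subseteq> Z \<union> Y" "S \<subseteq> Z \<union> Y"
      for P G O' S M Y using that by blast
    have "p ` A \<subseteq> {p a} \<union> Z" unfolding Z_def by blast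
    moreover have "\<Gamma> \<subseteq> Z" unfolding Z_def by blast
    moreover have "leg a' (outlet a') \<subseteq> Z \<union> (\<Union>x\<in>ports a - {port e}. leg a x)" if a': "a' \<in> Q" for a'
    proof (cases "a' = a")
      case True
      have "port e \<in> tails" using port_tail[OF e] e unfolding tails_def by blast
      moreover have "outlet a \<in> \<Gamma>" using outlet[of a] a' True by simp
      ultimately have "outlet a \<noteq> port e" using tails_\<Gamma> by auto
      then show ?thesis using True outlet_in_ports[OF a'] by blast
    next
      case False
      then have "leg a' (outlet a') \<subseteq> (\<Union>a'\<in>A - {a}. \<Union>x\<in>ports a'. leg a' x)" using a' Q(1) outlet_in_ports[OF a'] by blast
      then show ?thesis unfolding Z_def by blast
    qed
    then have "out_legs \<subseteq> Z \<union> (\<Union>x\<in>ports a - {port e}. leg a x)" unfolding out_legs_def by blast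
    moreover have "piece e' \<subseteq> Z \<union> (\<Union>x\<in>ports a - {port e}. leg a x)" if e': "e' \<in> E" "snd e' \<noteq> b" for e'
    proof -
      have t: "tail e' \<subseteq> Z" using e' unfolding Z_def tails_def by blast
      have "port e' \<noteq> port e" using port_inj[OF e'(1) e] e' b_def by blast
      then have "leg (fst e') (port e') \<subseteq> Z \<union> (\<Union>x\<in>ports a - {port e}. leg a x)"
        using port_in_ports[OF e'(1)] E_mem[OF e'(1)] unfolding Z_def by (cases "fst e' = a") blast+
      then show ?thesis using t unfolding piece_def by blast
    qed
    then have "star b' \<subseteq> Z \<union> (\<Union>x\<in>ports a - {port e}. leg a x)" if "b' \<noteq> b" for b'
      unfolding star_def using that by blast
    then have "(\<Union>b'\<in>B - {b}. star b') \<subseteq> Z \<union> (\<Union>x\<in>ports a - {port e}. leg a x)"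
      by (intro UN_least) simp
    ultimately show ?thesis unfolding obstacle_def by (rule un)
  qed
  obtain D where "wedge (p a) D" "D \<subseteq> collar (obstacle b) (star b)"
  proof (rule wedge_in_collar[OF obstacle_nonempty _ _ r1(1), of "p a" "c (port e)" "star b" "insert (p a) (c ` (ports a - {port e}))" b])
    show "closed_segment (p a) (c (port e)) \<subseteq> star b"
      using c[OF pT] e unfolding star_def piece_def a_def b_def by blast
    show "c (port e) \<noteq> p a" using c[OF pT] by blast
    show "finite (insert (p a) (c ` (ports a - {port e})))" using finite_ports by simp
    show "obstacle b \<inter> ball (p a) r1 \<subseteq> (\<Union>d\<in>insert (p a) (c ` (ports a - {port e})). closed_segment (p a) d)"
    proof
      fix x assume x: "x \<in> obstacle b \<inter> ball (p a) r1"
      then have "x \<notin> Z" using r0(2) subset_ball[OF r1(2), of "p a"] by blast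
      then consider "x = p a" | y where "y \<in> ports a - {port e}" "x \<in> leg a y" using XZ x by blast
      then show "x \<in> (\<Union>d\<in>insert (p a) (c ` (ports a - {port e})). closed_segment (p a) d)"
      proof cases
        case 2
        then have "x \<in> ball (p a) (\<rho> y)" using x subset_ball[OF r1(3), of y "p a"] by blast
        then show ?thesis using c[of y] 2 by blast
      qed simp
    qed
    fix d assume d: "d \<in> insert (p a) (c ` (ports a - {port e}))"
    show "closed_segment (p a) (c (port e)) \<inter> closed_segment (p a) d = {p a}"
    proof (cases "d = p a")
      case True then show ?thesis by auto
    next
      case False
      then obtain y where y: "y \<in> ports a" "y \<noteq> port e" "d = c y" using d by blast
      have "closed_segment (p a) (c (port e)) \<inter> closed_segment (p a) d \<subseteq> {p a}"
        using leg(4)[OF a pT y(1) y(2)[symmetric]] c[OF pT] c[OF y(1)] y(3) by blast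
      then show ?thesis by auto
    qed
  qed
  then show ?thesis unfolding nbhd_def a_def b_def by blast
qed

definition common :: "'a \<Rightarrow> 'a \<Rightarrow> 'a \<Rightarrow> bool" where
  "common u v b \<longleftrightarrow> (u, b) \<in> E \<and> (v, b) \<in> E"

lemma ex_drawing:
  assumes b: "b \<in> B"
  shows "\<exists>f. (\<forall>u v. u \<noteq> v \<longrightarrow> common u v b \<longrightarrow> joins (f {u, v}) (p u) (p v) \<and> f {u, v} - {p u, p v} \<subseteq> nbhd b) \<and>
    (\<forall>u v x y. common u v b \<longrightarrow> common x y b \<longrightarrow> u \<noteq> v \<longrightarrow> x \<noteq> y \<longrightarrow> {u, v} \<noteq> {x, y} \<longrightarrow>
       f {u, v} \<inter> f {x, y} \<subseteq> p ` ({u, v} \<inter> {x, y}))"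
proof -
  define N where "N = {a. (a, b) \<in> E}"
  have NA: "N \<subseteq> A" unfolding N_def using E by blast
  have N: "finite N" "card N \<le> 3" "inj_on p N"
    using finite_subset[OF NA fin(1)] deg[OF b] inj_on_subset[OF inj_p] NA by (auto simp: N_def)
  have w: "p v \<notin> nbhd b \<and> (\<exists>C. wedge (p v) C \<and> C \<subseteq> nbhd b)" if "v \<in> N" for v
    using wedge_nbhd[of "(v, b)"] that NA nbhd_props(3)[of b] unfolding N_def obstacle_def by auto
  show ?thesis
  proof (rule complete_graph_drawing[OF nbhd_props(1,2) N w])
    fix f assume f: "\<And>u v. u \<in> N \<Longrightarrow> v \<in> N \<Longrightarrow> u \<noteq> v \<Longrightarrow> joins (f {u, v}) (p u) (p v) \<and> f {u, v} - {p u, p v} \<subseteq> nbhd b"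
      "\<And>u v x y. u \<in> N \<Longrightarrow> v \<in> N \<Longrightarrow> x \<in> N \<Longrightarrow> y \<in> N \<Longrightarrow> u \<noteq> v \<Longrightarrow> x \<noteq> y \<Longrightarrow> {u, v} \<noteq> {x, y} \<Longrightarrow>
       f {u, v} \<inter> f {x, y} \<subseteq> p ` ({u, v} \<inter> {x, y})"
    show ?thesis by (rule exI[of _ f]) (use f in \<open>simp add: N_def common_def\<close>)
  qed
qed

definition local_drawing :: "'a \<Rightarrow> 'a set \<Rightarrow> complex set" where
  "local_drawing b = (SOME f. (\<forall>u v. u \<noteq> v \<longrightarrow> common u v b \<longrightarrow> joins (f {u, v}) (p u) (p v) \<and> f {u, v} - {p u, p v} \<subseteq> nbhd b) \<and>
    (\<forall>u v x y. common u v b \<longrightarrow> common x y b \<longrightarrow> u \<noteq> v \<longrightarrow> x \<noteq> y \<longrightarrow> {u, v} \<noteq> {x, y} \<longrightarrow>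
       f {u, v} \<inter> f {x, y} \<subseteq> p ` ({u, v} \<inter> {x, y})))"

definition edge :: "'a set \<Rightarrow> complex set" where
  "edge e = local_drawing (SOME b. \<forall>v\<in>e. (v, b) \<in> E) e"

lemma edge_cases:
  assumes "common u v b0" "u \<noteq> v"
  obtains b where "b \<in> B" "common u v b" "edge {u, v} = local_drawing b {u, v}"
    "joins (edge {u, v}) (p u) (p v)" "edge {u, v} - {p u, p v} \<subseteq> nbhd b"
proof -
  define b where "b = (SOME b. \<forall>x\<in>{u, v}. (x, b) \<in> E)"
  have "\<forall>x\<in>{u, v}. (x, b) \<in> E" unfolding b_def
    by (rule someI[of _ b0]) (use assms in \<open>auto simp: common_def\<close>)
  then have b: "common u v b" "b \<in> B" using E by (auto simp: common_def)
  have e: "edge {u, v} = local_drawing b {u, v}" unfolding edge_def b_def ..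
  note * = someI_ex[OF ex_drawing[OF b(2)], folded local_drawing_def]
  show ?thesis by (rule that[OF b(2,1) e]) (use * b assms(2) e in simp_all)
qed

theorem half_square:
  "u \<noteq> v \<Longrightarrow> common u v b \<Longrightarrow> joins (edge {u, v}) (p u) (p v) \<and> edge {u, v} \<inter> p ` A = {p u, p v}
    \<and> edge {u, v} \<inter> (\<Gamma> \<union> out_legs) \<subseteq> p ` A"
  "common u v b \<Longrightarrow> common x y b' \<Longrightarrow> u \<noteq> v \<Longrightarrow> x \<noteq> y \<Longrightarrow> {u, v} \<noteq> {x, y} \<Longrightarrow>
       edge {u, v} \<inter> edge {x, y} \<subseteq> p ` ({u, v} \<inter> {x, y})"
  "a \<in> Q \<Longrightarrow> \<exists>l y. l \<subseteq> out_legs \<and> y \<in> \<Gamma> \<and> joins l (p a) y \<and> l \<inter> p ` A = {p a}"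
proof -
  have UX: "nbhd b \<inter> p ` A = {}" "nbhd b \<inter> (\<Gamma> \<union> out_legs) = {}" for b
    using nbhd_props(3)[of b] unfolding obstacle_def by blast+
  have cA: "u \<in> A \<and> v \<in> A" if "common u v b" for u v b using that E unfolding common_def by blast
  show "joins (edge {u, v}) (p u) (p v) \<and> edge {u, v} \<inter> p ` A = {p u, p v}
    \<and> edge {u, v} \<inter> (\<Gamma> \<union> out_legs) \<subseteq> p ` A" if uv: "u \<noteq> v" "common u v b"
  proof -
    obtain c where c: "c \<in> B" "common u v c" "edge {u, v} = local_drawing c {u, v}"
      "joins (edge {u, v}) (p u) (p v)" "edge {u, v} - {p u, p v} \<subseteq> nbhd c"
      using edge_cases[OF uv(2,1)] .
    show ?thesis using c(4,5) joins_ends[OF c(4)] UX[of c] cA[OF c(2)] by blast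
  qed
  show "edge {u, v} \<inter> edge {x, y} \<subseteq> p ` ({u, v} \<inter> {x, y})"
    if *: "common u v b" "common x y b'" "u \<noteq> v" "x \<noteq> y" "{u, v} \<noteq> {x, y}"
  proof -
    obtain c where c: "c \<in> B" "common u v c" "edge {u, v} = local_drawing c {u, v}"
      "joins (edge {u, v}) (p u) (p v)" "edge {u, v} - {p u, p v} \<subseteq> nbhd c"
      using edge_cases[OF *(1,3)] .
    obtain d where d: "d \<in> B" "common x y d" "edge {x, y} = local_drawing d {x, y}"
      "joins (edge {x, y}) (p x) (p y)" "edge {x, y} - {p x, p y} \<subseteq> nbhd d"
      using edge_cases[OF *(2,4)] .
    show ?thesis
    proof (cases "c = d")
      case True
      note s = someI_ex[OF ex_drawing[OF c(1)], folded local_drawing_def, THEN conjunct2, rule_format]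
      show ?thesis unfolding c(3) d(3) True[symmetric]
        by (rule s) (use c(2) d(2) True * in auto)
    next
      case False
      have A: "u \<in> A" "v \<in> A" "x \<in> A" "y \<in> A" using cA *(1,2) by blast+
      have "edge {u, v} \<inter> edge {x, y} \<subseteq> {p u, p v} \<inter> {p x, p y}"
        using c(5) d(5) nbhds_disjoint[OF c(1) d(1) False] UX(1)[of c] UX(1)[of d] A by blast
      also have "\<dots> = p ` ({u, v} \<inter> {x, y})"
        using inj_on_image_Int[OF inj_p, of "{u, v}" "{x, y}"] A by simp
      finally show ?thesis .
    qed
  qed
  show "\<exists>l y. l \<subseteq> out_legs \<and> y \<in> \<Gamma> \<and> joins l (p a) y \<and> l \<inter> p ` A = {p a}" if "a \<in> Q"
    using leg(1)[of a "outlet a"] outlet[OF that] outlet_in_ports[OF that] leg_pA[of a "outlet a"] that Q(1) unfolding out_legs_def by blast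
qed

end

lemma uniform_gap:
  fixes q :: "'a \<Rightarrow> complex"
  assumes "finite A" "\<And>a. a \<in> A \<Longrightarrow> closed (C a) \<and> q a \<notin> C a" "(R::real) > 0"
  obtains d where "0 < d" "d \<le> R" "\<forall>a\<in>A. ball (q a) d \<inter> C a = {}"
proof -
  have "\<forall>a\<in>A. \<exists>d>0. ball (q a) d \<inter> C a = {}"
    using assms(2) by (metis ComplI disjoint_eq_subset_Compl open_Compl open_contains_ball)
  then obtain d where d: "\<And>a. a \<in> A \<Longrightarrow> d a > 0 \<and> ball (q a) (d a) \<inter> C a = {}" by metis
  define m where "m = Min (insert R (d ` A))"
  have m: "m > 0" "m \<le> R" "\<And>a. a \<in> A \<Longrightarrow> m \<le> d a"
    unfolding m_def using assms(1,3) d by (auto simp: Min_le_iff)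
  have "ball (q a) m \<inter> C a = {}" if "a \<in> A" for a
    using d[OF that] subset_ball[OF m(3)[OF that], of "q a"] by blast
  then show ?thesis using that m by blast
qed

lemma half_square_drawing:
  fixes A B Q :: "'a set" and p :: "'a \<Rightarrow> complex" and \<gamma> :: "'a \<times> 'a \<Rightarrow> real \<Rightarrow> complex"
  assumes fin: "finite A" "finite B" and AB: "A \<inter> B = {}" and E: "E \<subseteq> A \<times> B"
    and inj_p: "inj_on p (A \<union> B)"
    and arc: "\<And>e. e \<in> E \<Longrightarrow> arc (\<gamma> e)"
    and start: "\<And>e. e \<in> E \<Longrightarrow> \<gamma> e 0 = p (fst e)" and finish: "\<And>e. e \<in> E \<Longrightarrow> \<gamma> e 1 = p (snd e)"
    and vertex: "\<And>e v. e \<in> E \<Longrightarrow> v \<in> A \<union> B \<Longrightarrow> p v \<in> path_image (\<gamma> e) \<Longrightarrow> v \<in> {fst e, snd e}"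
    and cross: "\<And>e e'. e \<in> E \<Longrightarrow> e' \<in> E \<Longrightarrow> e \<noteq> e' \<Longrightarrow>
      path_image (\<gamma> e) \<inter> path_image (\<gamma> e') \<subseteq> p ` ({fst e, snd e} \<inter> {fst e', snd e'})"
    and deg: "\<And>b. b \<in> B \<Longrightarrow> card {a. (a, b) \<in> E} \<le> 3"
    and Q: "Q \<subseteq> A" "\<And>a. a \<in> Q \<Longrightarrow> p a \<in> frontier (outside (p ` (A \<union> B) \<union> (\<Union>e\<in>E. path_image (\<gamma> e))))"
  obtains f where
    "\<And>u v b. u \<noteq> v \<Longrightarrow> (u, b) \<in> E \<Longrightarrow> (v, b) \<in> E \<Longrightarrow>
       joins (f {u, v}) (p u) (p v) \<and> f {u, v} \<inter> p ` A = {p u, p v}"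
    "\<And>u v b x y b'. (u, b) \<in> E \<Longrightarrow> (v, b) \<in> E \<Longrightarrow> (x, b') \<in> E \<Longrightarrow> (y, b') \<in> E \<Longrightarrow> u \<noteq> v \<Longrightarrow> x \<noteq> y \<Longrightarrow>
       {u, v} \<noteq> {x, y} \<Longrightarrow> f {u, v} \<inter> f {x, y} \<subseteq> p ` ({u, v} \<inter> {x, y})"
    "\<And>a. a \<in> Q \<Longrightarrow> p a \<in> frontier (outside (p ` A \<union> \<Union>{f {u, v} | u v b. u \<noteq> v \<and> (u, b) \<in> E \<and> (v, b) \<in> E}))"
proof -
  define S where "S = p ` (A \<union> B) \<union> (\<Union>e\<in>E. path_image (\<gamma> e))"
  have finE: "finite E" using E fin by (meson finite_SigmaI finite_subset)
  have mem: "fst e \<in> A" "snd e \<in> B" if "e \<in> E" for e using that E by auto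
  have gap: "closed (p ` (A \<union> B - {a})) \<and> p a \<notin> p ` (A \<union> B - {a})" if "a \<in> A" for a
    using fin inj_onD[OF inj_p, of a] that by (auto intro!: finite_imp_closed)
  obtain R where R: "0 < R" "R \<le> 1" "\<forall>a\<in>A. ball (p a) R \<inter> p ` (A \<union> B - {a}) = {}"
    by (rule uniform_gap[OF fin(1) gap zero_less_one])
  define r where "r = R / 2"
  have r: "r > 0" using R by (simp add: r_def)
  have balls: "ball (p a) r \<inter> ball (p a') r = {}" if a: "a \<in> A" "a' \<in> A" "a \<noteq> a'" for a a'
  proof (rule disjoint_ballI)
    have "p a' \<notin> ball (p a) R" using R(3)[rule_format, OF a(1)] a by blast
    then show "r + r \<le> dist (p a) (p a')" by (simp add: r_def)
  qed
  have "\<exists>t. 0 < t \<and> t < 1 \<and> \<gamma> e ` {0..t} \<subseteq> ball (p (fst e)) r" if e: "e \<in> E" for e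
  proof -
    obtain t where t: "0 < t" "t \<le> 1" "\<gamma> e ` {0..t} \<subseteq> ball (\<gamma> e 0) r" using arc_initial[OF arc[OF e] r] .
    have "\<gamma> e ` {0..t/2} \<subseteq> \<gamma> e ` {0..t}" using t(1) by (intro image_mono) auto
    then show ?thesis using t start[OF e] by (intro exI[of _ "t/2"]) auto
  qed
  then obtain \<tau> where \<tau>: "\<And>e. e \<in> E \<Longrightarrow> 0 < \<tau> e \<and> \<tau> e < 1" "\<And>e. e \<in> E \<Longrightarrow> \<gamma> e ` {0..\<tau> e} \<subseteq> ball (p (fst e)) r"
    by metis
  define K where "K = (\<Union>e\<in>E. \<gamma> e ` {\<tau> e..1})"
  have jt: "joins (\<gamma> e ` {\<tau> e..1}) (\<gamma> e (\<tau> e)) (\<gamma> e 1)" if "e \<in> E" for e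
    using joins_subpath[OF arc[OF that], of "\<tau> e" 1] \<tau>(1)[OF that] by auto
  have "closed K" unfolding K_def using finE jt joins_compact compact_imp_closed by (intro closed_UN) blast+
  moreover have "p a \<notin> K" if a: "a \<in> A" for a
  proof
    assume "p a \<in> K"
    then obtain e t where e: "e \<in> E" "t \<in> {\<tau> e..1}" "p a = \<gamma> e t" unfolding K_def by blast
    then have t: "t \<in> {0..1}" "0 < t" using \<tau>(1)[OF e(1)] by auto
    then have "p a \<in> path_image (\<gamma> e)" unfolding e(3) path_image_def by blast
    then have "a = fst e" using vertex[OF e(1), of a] a mem[OF e(1)] AB by auto
    then have "\<gamma> e 0 = \<gamma> e t" using start[OF e(1)] e(3) by simp
    then show False using arc[OF e(1)] t unfolding arc_def inj_on_def by force
  qed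
  ultimately obtain \<delta> where \<delta>: "0 < \<delta>" "\<delta> \<le> r" "\<forall>a\<in>A. ball (p a) \<delta> \<inter> K = {}"
    using uniform_gap[OF fin(1), of "\<lambda>_. K" p r] r by auto
  have \<delta>v: "ball (p a) \<delta> \<inter> p ` (A \<union> B) \<subseteq> {p a}" if a: "a \<in> A" for a
    using R(3)[rule_format, OF a] \<delta>(2) r subset_ball[of \<delta> R "p a"] by (auto simp: r_def)
  have "compact (\<Union>e\<in>E. path_image (\<gamma> e))" using finE arc compact_arc_image by (intro compact_UN) blast+
  moreover have "compact (p ` (A \<union> B))" using fin by (intro finite_imp_compact) auto
  ultimately have S: "compact S" unfolding S_def by (rule compact_Un[rotated])
  then obtain R0 where R0: "R0 > 0" "S \<subseteq> ball 0 R0" using bounded_subset_ballD[of S 0] compact_imp_bounded by blast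
  define W where "W = outside S"
  have W: "open W" "connected W" "W \<inter> S = {}"
    unfolding W_def using S compact_imp_bounded connected_outside[of S] open_outside[of S] outside_no_overlap[of S]
    by (auto simp: compact_imp_closed)
  define \<Gamma>0 where "\<Gamma>0 = - ball (0::complex) R0"
  have \<Gamma>0: "\<Gamma>0 \<subseteq> W" "connected \<Gamma>0" "closed \<Gamma>0" "\<not> bounded \<Gamma>0"
    unfolding \<Gamma>0_def W_def using outside_subset_convex[OF convex_ball R0(2)]
      connected_complement_bounded_convex[of "ball (0::complex) R0"] cobounded_imp_unbounded[of "- ball (0::complex) R0"]
    by auto
  have w0: "of_real R0 \<in> \<Gamma>0" using R0 by (simp add: \<Gamma>0_def)
  have "\<exists>g. path g \<and> path_image g \<subseteq> W \<and> of_real R0 \<in> path_image g \<and> path_image g \<inter> ball (p a) \<delta> \<noteq> {}" if a: "a \<in> Q" for a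
  proof -
    have "p a \<in> closure W" using Q(2)[OF a] unfolding W_def S_def frontier_def by blast
    then obtain z where z: "z \<in> W" "dist z (p a) < \<delta>" using \<delta>(1) closure_approachable by blast
    have "path_connected W" using W connected_open_path_connected by blast
    then obtain g where g: "path g" "path_image g \<subseteq> W" "pathstart g = of_real R0" "pathfinish g = z"
      unfolding path_connected_def using w0 \<Gamma>0 z by blast
    then have "of_real R0 \<in> path_image g" "z \<in> path_image g" by (metis pathstart_in_path_image, metis pathfinish_in_path_image)
    then show ?thesis using g z by (intro exI[of _ g]) (auto simp: dist_commute)
  qed
  then obtain g where g: "\<And>a. a \<in> Q \<Longrightarrow> path (g a) \<and> path_image (g a) \<subseteq> W \<and> of_real R0 \<in> path_image (g a) \<and>
    path_image (g a) \<inter> ball (p a) \<delta> \<noteq> {}" by metis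
  define \<Gamma> where "\<Gamma> = \<Gamma>0 \<union> (\<Union>a\<in>Q. path_image (g a))"
  have finQ: "finite Q" using Q(1) fin(1) finite_subset by blast
  have \<Gamma>W: "\<Gamma> \<subseteq> W" unfolding \<Gamma>_def using \<Gamma>0 g by blast
  have "closed (\<Union>a\<in>Q. path_image (g a))" using finQ g closed_path_image by (intro closed_UN) blast+
  then have cl\<Gamma>: "closed \<Gamma>" unfolding \<Gamma>_def using \<Gamma>0(3) by (rule closed_Un[rotated])
  have con\<Gamma>: "connected \<Gamma>"
  proof -
    have "connected (\<Union>(insert \<Gamma>0 ((\<lambda>a. path_image (g a)) ` Q)))"
      using \<Gamma>0 g w0 connected_path_image by (intro connected_Union) blast+
    then show ?thesis unfolding \<Gamma>_def by simp
  qed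
  have un\<Gamma>: "\<not> bounded \<Gamma>" using \<Gamma>0(4) bounded_subset unfolding \<Gamma>_def by blast
  interpret cut_drawing A B E p \<gamma> \<tau> r \<delta> \<Gamma> Q
  proof
    show "\<Gamma> \<noteq> {}" using w0 unfolding \<Gamma>_def by blast
    show "\<Gamma> \<inter> (p ` (A \<union> B) \<union> (\<Union>e\<in>E. path_image (\<gamma> e))) = {}" using \<Gamma>W W(3) unfolding S_def by blast
    show "ball (p a) \<delta> \<inter> (\<Union>e\<in>E. \<gamma> e ` {\<tau> e..1}) = {}" if "a \<in> A" for a using \<delta>(3)[rule_format, OF that] unfolding K_def .
    show "\<Gamma> \<inter> ball (p a) \<delta> \<noteq> {}" if "a \<in> Q" for a using g[OF that] that unfolding \<Gamma>_def by blast
  qed (use fin AB E inj_p arc start finish vertex cross deg \<tau> r balls \<delta> \<delta>v cl\<Gamma> Q in auto)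
  show ?thesis
  proof (rule that[of edge])
    fix u v b assume "u \<noteq> v" "(u, b) \<in> E" "(v, b) \<in> E"
    then show "joins (edge {u, v}) (p u) (p v) \<and> edge {u, v} \<inter> p ` A = {p u, p v}"
      using half_square(1)[of u v b] unfolding common_def by blast
  next
    fix u v b x y b' assume "(u, b) \<in> E" "(v, b) \<in> E" "(x, b') \<in> E" "(y, b') \<in> E" "u \<noteq> v" "x \<noteq> y" "{u, v} \<noteq> {x, y}"
    then show "edge {u, v} \<inter> edge {x, y} \<subseteq> p ` ({u, v} \<inter> {x, y})"
      using half_square(2)[of u v b x y b'] unfolding common_def by blast
  next
    fix a assume a: "a \<in> Q"
    define F where "F = p ` A \<union> \<Union>{edge {u, v} | u v b. u \<noteq> v \<and> (u, b) \<in> E \<and> (v, b) \<in> E}"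
    obtain l y where l: "l \<subseteq> out_legs" "y \<in> \<Gamma>" "joins l (p a) y" "l \<inter> p ` A = {p a}"
      using half_square(3)[OF a] by blast
    have FG: "F \<inter> (\<Gamma> \<union> out_legs) \<subseteq> p ` A" unfolding F_def using half_square(1) unfolding common_def by blast
    have paA: "p ` A \<inter> \<Gamma> = {}" using \<Gamma>W W(3) unfolding S_def by blast
    define C where "C = \<Gamma> \<union> (l - {p a})"
    have "y \<in> l" "y \<noteq> p a" using joins_ends[OF l(3)] by auto
    then have "connected C" unfolding C_def
      using con\<Gamma> joins_connected(1)[OF l(3)] l(2) by (intro connected_Un) blast+
    moreover have "C \<subseteq> - F" using FG paA l unfolding C_def by blast
    moreover have "\<not> bounded C" using un\<Gamma> bounded_subset unfolding C_def by blast
    ultimately have "l - {p a} \<subseteq> outside F"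
    proof -
      assume C: "connected C" "C \<subseteq> - F" "\<not> bounded C"
      have "x \<in> outside F" if x: "x \<in> C" for x
      proof -
        have "C \<subseteq> connected_component_set (- F) x" using C x by (intro connected_component_maximal) auto
        then show ?thesis using C x bounded_subset unfolding outside_def by blast
      qed
      then show ?thesis unfolding C_def by blast
    qed
    then have "p a \<in> closure (outside F)" using joins_closure_minus_end[OF l(3)] closure_mono by blast
    moreover have "p a \<notin> outside F" using a Q(1) outside_no_overlap[of F] unfolding F_def by blast
    ultimately have "p a \<in> frontier (outside F)" using interior_subset unfolding frontier_def by blast
    then show "p a \<in> frontier (outside (p ` A \<union> \<Union>{edge {u, v} | u v b. u \<noteq> v \<and> (u, b) \<in> E \<and> (v, b) \<in> E}))"
      unfolding F_def .
  qed
qed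

section \<open>Exact squares\<close>

lemma (in pair_graph) parcs_sym: "(u, v) \<in> parcs G \<Longrightarrow> (v, u) \<in> parcs G"
  using graph_symmetric[of u v] by simp

lemma plane_drawing_iff:
  "plane_drawing G p D \<longleftrightarrow> inj_on p (verts G) \<and>
     (\<forall>u v. (u, v) \<in> arcs_ends G \<longrightarrow> joins (D {u, v}) (p u) (p v) \<and> D {u, v} \<inter> p ` verts G = {p u, p v}) \<and>
     (\<forall>u v x y. (u, v) \<in> arcs_ends G \<longrightarrow> (x, y) \<in> arcs_ends G \<longrightarrow> {u, v} \<noteq> {x, y} \<longrightarrow>
        D {u, v} \<inter> D {x, y} \<subseteq> p ` ({u, v} \<inter> {x, y}))"
  unfolding plane_drawing_def joins_def by (simp only: Ball_def split_paired_All case_prod_conv) meson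

locale bipartite_graph = pair_graph G for G :: "'a pair_pre_digraph" +
  fixes A B :: "'a set"
  assumes bip: "bipartition (with_proj G) A B"
begin

lemma parts: "A \<union> B = pverts G" "A \<inter> B = {}"
  using bip by (auto simp: bipartition_def)

lemma arc_parts: "(u, v) \<in> parcs G \<Longrightarrow> u \<in> A \<and> v \<in> B \<or> u \<in> B \<and> v \<in> A"
  using bip by (auto simp: bipartition_def)

lemma arc_part_iff: "(u, v) \<in> parcs G \<Longrightarrow> (u \<in> A \<longleftrightarrow> v \<in> B) \<and> (u \<in> B \<longleftrightarrow> v \<in> A)"
  using arc_parts parts by blast

lemma graph_dist_eq_2_iff:
  assumes "u \<noteq> v"
  shows "graph_dist (with_proj G) u v = 2 \<longleftrightarrow> (\<exists>w. (u, w) \<in> parcs G \<and> (w, v) \<in> parcs G)"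
proof -
  have cost: "awalk_cost (\<lambda>_. 1) q = real (length q)" for q :: "('a \<times> 'a) list"
    by (induction q) auto
  have mu: "graph_dist (with_proj G) u v = (INF q\<in>{q. awalk u q v}. ereal (real (length q)))"
    unfolding graph_dist_def \<mu>_def cost ..
  have pos: "q \<noteq> []" if "awalk u q v" for q using that assms by (auto simp: awalk_Nil_iff)
  show ?thesis
  proof
    assume eq: "graph_dist (with_proj G) u v = 2"
    then have "(INF q\<in>{q. awalk u q v}. ereal (real (length q))) < 3" unfolding mu by simp
    then obtain q where q: "awalk u q v" "length q < 3" unfolding INF_less_iff by auto
    have "2 \<le> ereal (real (length q))" unfolding eq[symmetric] mu using q(1) by (intro INF_lower) simp
    then have "length q = 2" using q(2) by simp
    then obtain e f where "q = [e, f]" by (auto simp: length_Suc_conv numeral_2_eq_2)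
    then show "\<exists>w. (u, w) \<in> parcs G \<and> (w, v) \<in> parcs G"
      using q(1) by (cases e; cases f) (auto simp: awalk_Cons_iff awalk_Nil_iff)
  next
    assume "\<exists>w. (u, w) \<in> parcs G \<and> (w, v) \<in> parcs G"
    then obtain w where w: "(u, w) \<in> parcs G" "(w, v) \<in> parcs G" by blast
    have "awalk u [(u, w), (w, v)] v" using w in_arcsD2[OF w(2)] by (simp add: awalk_Cons_iff awalk_Nil_iff)
    then have "graph_dist (with_proj G) u v \<le> ereal (real (length [(u, w), (w, v)]))"
      unfolding mu by (intro INF_lower) simp
    moreover have "2 \<le> ereal (real (length q))" if q: "awalk u q v" for q
    proof -
      have "length q \<noteq> 1"
      proof
        assume "length q = 1"
        then obtain e where "q = [e]" by (auto simp: length_Suc_conv)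
        then have "(u, v) \<in> parcs G" using q by (cases e) (auto simp: awalk_Cons_iff awalk_Nil_iff)
        then show False using arc_parts[of u v] arc_part_iff[OF w(1)] arc_part_iff[OF w(2)] parts(2) by blast
      qed
      moreover have "length q \<noteq> 0" using pos[OF q] by simp
      ultimately have "2 \<le> length q" by linarith
      then show ?thesis by simp
    qed
    then have "2 \<le> graph_dist (with_proj G) u v" unfolding mu by (intro INF_greatest) simp
    ultimately show "graph_dist (with_proj G) u v = 2" by simp
  qed
qed

lemma exact_square_arc_iff:
  "(u, v) \<in> parcs (exact_square G) \<longleftrightarrow> u \<noteq> v \<and> (\<exists>w. (u, w) \<in> parcs G \<and> (v, w) \<in> parcs G)"
proof
  assume "(u, v) \<in> parcs (exact_square G)"
  then show "u \<noteq> v \<and> (\<exists>w. (u, w) \<in> parcs G \<and> (v, w) \<in> parcs G)"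
    using graph_dist_eq_2_iff[of u v] parcs_sym unfolding exact_square_def by auto
next
  assume r: "u \<noteq> v \<and> (\<exists>w. (u, w) \<in> parcs G \<and> (v, w) \<in> parcs G)"
  then show "(u, v) \<in> parcs (exact_square G)"
    using graph_dist_eq_2_iff[of u v] parcs_sym in_arcsD1 unfolding exact_square_def by auto
qed

lemma exact_square_wf: "wf_digraph (with_proj (exact_square G))"
  by unfold_locales (auto simp: exact_square_def)

lemma exact_square_part:
  assumes "(u, v) \<in> parcs (exact_square G)" shows "u \<in> A \<longleftrightarrow> v \<in> A"
  using assms arc_part_iff unfolding exact_square_arc_iff by blast

lemma reachable_part:
  assumes "u \<rightarrow>\<^sup>*\<^bsub>with_proj (exact_square G)\<^esub> v" shows "u \<in> A \<longleftrightarrow> v \<in> A"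
proof -
  interpret S: wf_digraph "with_proj (exact_square G)" by (rule exact_square_wf)
  show ?thesis using assms by (induction rule: S.reachable_induct) (use exact_square_part in auto)
qed

lemma reachable_exact_square:
  assumes uv: "u \<in> A" "v \<in> A" and reach: "u \<rightarrow>\<^sup>*\<^bsub>with_proj G\<^esub> v"
  shows "u \<rightarrow>\<^sup>*\<^bsub>with_proj (exact_square G)\<^esub> v"
proof -
  interpret S: wf_digraph "with_proj (exact_square G)" by (rule exact_square_wf)
  have "(v \<in> A \<longrightarrow> u \<rightarrow>\<^sup>*\<^bsub>with_proj (exact_square G)\<^esub> v) \<and>
    (v \<in> B \<longrightarrow> (\<forall>y. (v, y) \<in> parcs G \<longrightarrow> u \<rightarrow>\<^sup>*\<^bsub>with_proj (exact_square G)\<^esub> y))"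
    using reach
  proof (induction rule: reachable_induct)
    case base
    have "u \<in> pverts (exact_square G)" using uv parts by (auto simp: exact_square_def)
    then show ?case using uv parts by auto
  next
    case (step x y)
    have xy: "(x, y) \<in> parcs G" using step by simp
    show ?case
    proof (intro conjI impI allI)
      assume "y \<in> A" then show "u \<rightarrow>\<^sup>*\<^bsub>with_proj (exact_square G)\<^esub> y"
        using step arc_part_iff[OF xy] xy by blast
    next
      fix z assume y: "y \<in> B" and yz: "(y, z) \<in> parcs G"
      have ux: "u \<rightarrow>\<^sup>*\<^bsub>with_proj (exact_square G)\<^esub> x" using step arc_part_iff[OF xy] y by blast
      show "u \<rightarrow>\<^sup>*\<^bsub>with_proj (exact_square G)\<^esub> z"
      proof (cases "x = z")
        case False
        then have "(x, z) \<in> parcs (exact_square G)"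
          unfolding exact_square_arc_iff using xy parcs_sym[OF yz] by blast
        then show ?thesis using S.reachable_adj_trans[OF ux] by simp
      qed (use ux in simp)
    qed
  qed
  then show ?thesis using uv by blast
qed

lemma swap: "bipartite_graph G B A"
  using bip by unfold_locales (auto simp: bipartition_def)

lemma half_square_plane_drawing:
  assumes pd: "plane_drawing (with_proj G) p D" and sub: "subcubic (with_proj G)"
  shows "\<exists>D'. plane_drawing (with_proj (exact_square G) \<restriction> A) p D' \<and>
    (p ` pverts G \<subseteq> frontier (outside (drawing_points (with_proj G) p D)) \<longrightarrow>
     p ` A \<subseteq> frontier (outside (drawing_points (with_proj (exact_square G) \<restriction> A) p D')))"
proof -
  define E where "E = {(a, b). a \<in> A \<and> (a, b) \<in> parcs G}"
  have EG: "(a, b) \<in> E \<longleftrightarrow> a \<in> A \<and> (a, b) \<in> parcs G" for a b by (simp add: E_def)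
  have EAB: "E \<subseteq> A \<times> B" using arc_part_iff by (auto simp: E_def)
  have fin: "finite A" "finite B" using pair_finite_verts parts(1) by (metis finite_Un)+
  have inj_p: "inj_on p (A \<union> B)" using pd unfolding plane_drawing_def parts(1) by simp
  have arcs: "joins (D {u, v}) (p u) (p v)" "D {u, v} \<inter> p ` (A \<union> B) = {p u, p v}"
    if "(u, v) \<in> parcs G" for u v
    using pd that unfolding plane_drawing_iff parts(1) by simp_all
  have cross: "D {u, v} \<inter> D {x, y} \<subseteq> p ` ({u, v} \<inter> {x, y})"
    if "(u, v) \<in> parcs G" "(x, y) \<in> parcs G" "{u, v} \<noteq> {x, y}" for u v x y
    using pd that unfolding plane_drawing_iff by simp
  have "\<forall>e\<in>E. \<exists>g. Path_Connected.arc g \<and> pathstart g = p (fst e) \<and> pathfinish g = p (snd e) \<and> path_image g = D {fst e, snd e}"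
    using arcs(1) unfolding joins_def by (auto simp: EG)
  then obtain \<gamma> where \<gamma>: "\<And>e. e \<in> E \<Longrightarrow> Path_Connected.arc (\<gamma> e) \<and> pathstart (\<gamma> e) = p (fst e) \<and> pathfinish (\<gamma> e) = p (snd e)
      \<and> path_image (\<gamma> e) = D {fst e, snd e}" by metis
  have EP: "(fst e, snd e) \<in> parcs G" "fst e \<in> A" "snd e \<in> B" if "e \<in> E" for e using that EAB by (auto simp: E_def)
  have points: "drawing_points (with_proj G) p D = p ` (A \<union> B) \<union> (\<Union>e\<in>E. path_image (\<gamma> e))"
  proof -
    have "(\<Union>(u, v)\<in>parcs G. D {u, v}) = (\<Union>e\<in>E. D {fst e, snd e})"
    proof
      show "(\<Union>(u, v)\<in>parcs G. D {u, v}) \<subseteq> (\<Union>e\<in>E. D {fst e, snd e})"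
      proof clarify
        fix x u v assume uv: "(u, v) \<in> parcs G" "x \<in> D {u, v}"
        show "x \<in> (\<Union>e\<in>E. D {fst e, snd e})"
        proof (cases "u \<in> A")
          case True
          then show ?thesis using uv by (intro UN_I[of "(u, v)"]) (auto simp: EG)
        next
          case False
          then have "v \<in> A" using arc_parts[OF uv(1)] by blast
          then show ?thesis using uv parcs_sym[OF uv(1)]
            by (intro UN_I[of "(v, u)"]) (auto simp: EG insert_commute)
        qed
      qed
    qed (use EP(1) in fastforce)
    also have "\<dots> = (\<Union>e\<in>E. path_image (\<gamma> e))" using \<gamma> by simp
    finally show ?thesis unfolding drawing_points_def parts(1) by simp
  qed
  define Q where "Q = (if p ` pverts G \<subseteq> frontier (outside (drawing_points (with_proj G) p D)) then A else {})"
  have vertex: "v \<in> {fst e, snd e}" if e: "e \<in> E" and v: "v \<in> A \<union> B" "p v \<in> path_image (\<gamma> e)" for e v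
  proof -
    have "p v \<in> {p (fst e), p (snd e)}" using arcs(2)[OF EP(1)[OF e]] \<gamma>[OF e] v by blast
    then show ?thesis using inj_onD[OF inj_p, of v] v(1) EP[OF e] by blast
  qed
  have crossE: "path_image (\<gamma> e) \<inter> path_image (\<gamma> e') \<subseteq> p ` ({fst e, snd e} \<inter> {fst e', snd e'})"
    if e: "e \<in> E" "e' \<in> E" "e \<noteq> e'" for e e'
  proof -
    have "{fst e, snd e} \<noteq> {fst e', snd e'}"
      using EP[OF e(1)] EP[OF e(2)] parts(2) e(3) by (auto simp: doubleton_eq_iff prod_eq_iff)
    then show ?thesis using cross[OF EP(1)[OF e(1)] EP(1)[OF e(2)]] \<gamma>[OF e(1)] \<gamma>[OF e(2)] by simp
  qed
  have deg: "card {a. (a, b) \<in> E} \<le> 3" if b: "b \<in> B" for b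
  proof -
    have "{a. (a, b) \<in> E} \<subseteq> snd ` out_arcs (with_proj G) b"
      using parcs_sym by (force simp: EG out_arcs_def)
    moreover have fo: "finite (out_arcs (with_proj G) b)"
      using pair_finite_arcs by (rule finite_subset[rotated]) (auto simp: out_arcs_def)
    ultimately have "card {a. (a, b) \<in> E} \<le> card (out_arcs (with_proj G) b)"
      by (meson card_image_le card_mono finite_imageI le_trans)
    also have "\<dots> \<le> 3" using sub b parts(1) unfolding subcubic_def out_degree_def by auto
    finally show ?thesis .
  qed
  have st: "\<gamma> e 0 = p (fst e)" "\<gamma> e 1 = p (snd e)" "Path_Connected.arc (\<gamma> e)" if "e \<in> E" for e
    using \<gamma>[OF that] by (auto simp: pathstart_def pathfinish_def)
  have QA: "Q \<subseteq> A" by (simp add: Q_def)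
  have Qf: "p a \<in> frontier (outside (p ` (A \<union> B) \<union> (\<Union>e\<in>E. path_image (\<gamma> e))))" if "a \<in> Q" for a
    using that parts(1) unfolding points[symmetric] by (auto simp: Q_def split: if_splits)
  show ?thesis
  proof (rule half_square_drawing[OF fin parts(2) EAB inj_p st(3,1,2) vertex crossE deg QA Qf])
    fix f assume f: "\<And>u v b. u \<noteq> v \<Longrightarrow> (u, b) \<in> E \<Longrightarrow> (v, b) \<in> E \<Longrightarrow>
         joins (f {u, v}) (p u) (p v) \<and> f {u, v} \<inter> p ` A = {p u, p v}"
      "\<And>u v b x y b'. (u, b) \<in> E \<Longrightarrow> (v, b) \<in> E \<Longrightarrow> (x, b') \<in> E \<Longrightarrow> (y, b') \<in> E \<Longrightarrow> u \<noteq> v \<Longrightarrow> x \<noteq> y \<Longrightarrow>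
         {u, v} \<noteq> {x, y} \<Longrightarrow> f {u, v} \<inter> f {x, y} \<subseteq> p ` ({u, v} \<inter> {x, y})"
      "\<And>a. a \<in> Q \<Longrightarrow> p a \<in> frontier (outside (p ` A \<union> \<Union>{f {u, v} | u v b. u \<noteq> v \<and> (u, b) \<in> E \<and> (v, b) \<in> E}))"
    let ?H = "with_proj (exact_square G) \<restriction> A"
    have ends: "(u, v) \<in> arcs_ends ?H \<longleftrightarrow> u \<noteq> v \<and> (\<exists>b. (u, b) \<in> E \<and> (v, b) \<in> E)" for u v
    proof -
      have "(u, v) \<in> arcs_ends ?H \<longleftrightarrow> u \<in> A \<and> v \<in> A \<and> (u, v) \<in> parcs (exact_square G)"
        by (auto simp: arcs_ends_conv image_iff)
      then show ?thesis unfolding exact_square_arc_iff EG by blast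
    qed
    have "plane_drawing ?H p f" unfolding plane_drawing_iff
    proof (intro conjI allI impI)
      show "inj_on p (verts ?H)" using inj_p by (auto intro: inj_on_subset)
    next
      fix u v assume "(u, v) \<in> arcs_ends ?H"
      then obtain b where b: "u \<noteq> v" "(u, b) \<in> E" "(v, b) \<in> E" unfolding ends by blast
      show "joins (f {u, v}) (p u) (p v)" "f {u, v} \<inter> p ` verts ?H = {p u, p v}" using f(1)[OF b] by simp_all
    next
      fix u v x y assume "(u, v) \<in> arcs_ends ?H" "(x, y) \<in> arcs_ends ?H" and ne: "{u, v} \<noteq> {x, y}"
      then obtain b b' where "u \<noteq> v" "(u, b) \<in> E" "(v, b) \<in> E" "x \<noteq> y" "(x, b') \<in> E" "(y, b') \<in> E"
        unfolding ends by blast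
      then show "f {u, v} \<inter> f {x, y} \<subseteq> p ` ({u, v} \<inter> {x, y})" using f(2) ne by simp
    qed
    moreover have "drawing_points ?H p f = p ` A \<union> \<Union>{f {u, v} | u v b. u \<noteq> v \<and> (u, b) \<in> E \<and> (v, b) \<in> E}"
    proof -
      have "(\<Union>(u, v)\<in>arcs_ends ?H. f {u, v}) = \<Union>{f {u, v} | u v b. u \<noteq> v \<and> (u, b) \<in> E \<and> (v, b) \<in> E}"
      proof -
        have "arcs_ends ?H = {(u, v). u \<noteq> v \<and> (\<exists>b. (u, b) \<in> E \<and> (v, b) \<in> E)}" using ends by auto
        then show ?thesis by (simp only:) blast
      qed
      then show ?thesis unfolding drawing_points_def by simp
    qed
    ultimately show ?thesis using f(3) unfolding Q_def by (intro exI[of _ f]) auto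
  qed
qed

lemma half_planar:
  assumes "planar (with_proj G)" "subcubic (with_proj G)"
  shows "planar (with_proj (exact_square G) \<restriction> A)"
  using half_square_plane_drawing assms unfolding planar_def by blast

lemma half_outerplanar:
  assumes "outerplanar (with_proj G)" "subcubic (with_proj G)"
  shows "outerplanar (with_proj (exact_square G) \<restriction> A)"
proof -
  obtain p D where "plane_drawing (with_proj G) p D"
    "p ` pverts G \<subseteq> frontier (outside (drawing_points (with_proj G) p D))"
    using assms(1) unfolding outerplanar_def by auto
  then show ?thesis
    using half_square_plane_drawing[of p D] assms(2) unfolding outerplanar_def induce_subgraph_verts by blast
qed

lemma part_in_sccs_verts:
  assumes "Digraph_Component.connected (with_proj G)" "A \<noteq> {}"
  shows "A \<in> pre_digraph.sccs_verts (with_proj (exact_square G))"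
proof -
  have "u \<rightarrow>\<^sup>*\<^bsub>with_proj G\<^esub> v" if "u \<in> pverts G" "v \<in> pverts G" for u v
    using symmetric_connected_imp_strongly_connected[OF sym_arcs assms(1)] that
    unfolding strongly_connected_def by simp
  then show ?thesis unfolding pre_digraph.sccs_verts_def
    using assms(2) reachable_exact_square reachable_part parts(1) by blast
qed

end

theorem theorem9:
  fixes G :: "'a pair_pre_digraph" and A B :: "'a set"
  assumes "pair_graph G"
    and "Digraph_Component.connected (with_proj G)"
    and "bipartition (with_proj G) A B"
    and "planar (with_proj G)"
    and "subcubic (with_proj G)"
  shows "pre_digraph.sccs (with_proj (exact_square G)) =
           (\<lambda>X. with_proj (exact_square G) \<restriction> X) ` ({A, B} - {{}}) \<and>
         (card (pverts G) \<ge> 2 \<longrightarrow> card (pre_digraph.sccs (with_proj (exact_square G))) = 2) \<and>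
         (\<forall>C \<in> pre_digraph.sccs (with_proj (exact_square G)). planar C) \<and>
         (outerplanar (with_proj G) \<longrightarrow>
           (\<forall>C \<in> pre_digraph.sccs (with_proj (exact_square G)). outerplanar C))"
proof -
  interpret bipartite_graph G A B
    using assms(1,3) by (simp add: bipartite_graph_def bipartite_graph_axioms_def)
  interpret swapped: bipartite_graph G B A by (rule swap)
  interpret S: wf_digraph "with_proj (exact_square G)" by (rule exact_square_wf)
  have parts_sccs: "X \<in> S.sccs_verts" if "X \<in> {A, B} - {{}}" for X
    using part_in_sccs_verts[OF assms(2)] swapped.part_in_sccs_verts[OF assms(2)] that by blast
  have verts: "S.sccs_verts = {A, B} - {{}}"
  proof
    show "S.sccs_verts \<subseteq> {A, B} - {{}}"
    proof
      fix X assume X: "X \<in> S.sccs_verts"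
      then obtain u where u: "u \<in> X" "u \<rightarrow>\<^sup>*\<^bsub>with_proj (exact_square G)\<^esub> u"
        unfolding S.in_sccs_verts_conv_reachable by blast
      then have "u \<in> pverts G" using S.reachable_in_verts(1)[OF u(2)] by (simp add: exact_square_def)
      then obtain Y where Y: "Y \<in> {A, B} - {{}}" "u \<in> Y" using parts(1) by blast
      then have "X = Y" using S.sccs_verts_disjoint[OF X parts_sccs[OF Y(1)]] u(1) by blast
      then show "X \<in> {A, B} - {{}}" using Y by simp
    qed
  qed (use parts_sccs in blast)
  have sccs: "S.sccs = (\<lambda>X. with_proj (exact_square G) \<restriction> X) ` ({A, B} - {{}})"
    unfolding S.sccs_conv_sccs_verts verts ..
  moreover have "card S.sccs = 2" if card: "card (pverts G) \<ge> 2"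
  proof -
    obtain u v where uv: "u \<in> pverts G" "v \<in> pverts G" "u \<noteq> v"
      using card by (metis card_le_Suc0_iff_eq not_less_eq_eq numeral_2_eq_2 pair_finite_verts)
    have "u \<rightarrow>\<^sup>*\<^bsub>with_proj G\<^esub> v"
      using symmetric_connected_imp_strongly_connected[OF sym_arcs assms(2)] uv
      unfolding strongly_connected_def by simp
    then obtain w where "(u, w) \<in> parcs G"
      using uv(3) by (cases rule: converse_reachable_cases) auto
    then have "A \<noteq> {}" "B \<noteq> {}" using arc_parts by blast+
    then have "card S.sccs_verts = 2" unfolding verts using parts(2) by (auto simp: card_2_iff)
    then show ?thesis by (simp add: S.card_sccs_verts)
  qed
  moreover have "\<forall>C\<in>S.sccs. planar C"
    unfolding sccs using half_planar[OF assms(4,5)] swapped.half_planar[OF assms(4,5)] by auto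
  moreover have "\<forall>C\<in>S.sccs. outerplanar C" if "outerplanar (with_proj G)"
    unfolding sccs using half_outerplanar[OF that assms(5)] swapped.half_outerplanar[OF that assms(5)] by auto
  ultimately show ?thesis by blast
qed

end
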